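(* Let $(\Lambda,\mathfrak p^\pm)$ be a linear Weingarten surface with real sphere complexes $\mathfrak p^\pm$ in a hyperbolic space form, rotational with respect to a parabolic 1-parameter subgroup of rotations $\rho^1$, and let $\{\mathfrak p^+,\mathfrak p^-,\mathfrak v,\mathfrak e_1,\mathfrak o,\mathfrak e_2\}$ and $\kappa^\pm,\varepsilon,\Delta$ be the adapted basis of $\mathbb{R}^{4,2}$ and the constants described in the context; assume $\kappa^-\ne0$. Let $\mathfrak s^+$ be the Christoffel dual lift of the isothermic sphere congruence $s^+$ normalized by $(\mathfrak s^+,\mathfrak p^+)=0$, $(\mathfrak s^+,\mathfrak p^-)=\Delta$, written in polar coordinates (in the adapted basis) as $$\mathfrak s^+(\theta,t)=\rho^1_\theta\,\rho^2_{\psi(t)}\big(-\varepsilon,\ \kappa^+,\ d(t),\ 0,\ r(t),\ 0\big)^\top .$$ Then $\mathfrak s^+$ can be parametrized (by choice of the parameter $t$) such that its coordinate functions satisfy $$(r')^2=\frac{\kappa^-}{\Delta^2}(r^2-C_1)(r^2-C_2),\qquad \psi'=\sqrt{-\tfrac1\Delta}\ \frac{\varepsilon r^2+\kappa^+C}{r^2},\qquad d=\frac{\kappa^+\Delta}{2r},$$ where $C$ is the real constant of the Christoffel duality, $\mathfrak s^-_\theta=C\,\mathfrak s^+_\theta/|\mathfrak s^+_\theta|^2$, and $C_1,C_2$ are the (real) roots of the polynomial $$p_C(x)=\kappa^-x^2+2C\varepsilon x+\kappa^+C^2 .$$ ($\psi'$ is determined only up to sign, since $\psi\mapsto-\psi$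 amounts to a rigid motion.)
   Context: $\mathbb{R}^{4,2}$ is the real 6-dimensional vector space with inner product of signature $(++++--)$, $L^{4,1}$ its set of lightlike vectors, and the Lie quadric $\mathcal L=\{\langle\mathfrak v\rangle:\mathfrak v\ne0\text{ lightlike}\}$. A sphere congruence is a map $s:\Sigma^2\to\mathcal L$; a lift $\mathfrak s\in\Gamma s$ is a map into $L^{4,1}$ with $\langle\mathfrak s\rangle=s$. A Legendre immersion $\Lambda$ assigns to each point of $\Sigma^2$ a totally isotropic 2-plane $\Lambda=\langle\mathfrak s_1,\mathfrak s_2\rangle$ with $(d\mathfrak s_1,\mathfrak s_2)=0$, such that $d_p\mathfrak s(X)\in\Lambda(p)$ for all $\mathfrak s\in\Gamma\Lambda$ implies $X=0$. It envelopes $s$ if $s(p)\subset\Lambda(p)$ for all $p$. Its curvature sphere congruences $s_1,s_2$ are enveloped sphere congruences such that in suitable coordinates $(u,v)$ (curvature line coordinates) $(\mathfrak s_1)_u,(\mathfrak s_2)_v\in\Gamma\Lambda$ for any lifts. A sphere congruence is isothermic if it has a lift $\mathfrak s$ with $\mathfrak s_{uv}\parallel\mathfrak s$ for suitable coordinates. $\Lambda$ is an $\Omega$-surface if it envelopes a (possibly complex conjugate) pair of isothermic sphere congruences $s^\pm$ separating the curvature sphere congruences harmonically. It then has Christoffel dual lifts $\mathfrak s^\pm\in\Gamma s^\pm$, unique up to constant rescalings, i.e. in curvature line coordinates $\mathfrak s^-_u=CU\,\mathfrak s^+_u/|\mathfrak s^+_u|^2$, $\mathfrak s^-_v=-CV\,\mathfrak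 s^+_v/|\mathfrak s^+_v|^2$ with $U=U(u),V=V(v)$ and $C$ constant (for rotational surfaces, with $u=\theta$, $U$ is constant and taken to be $1$). A linear Weingarten surface $(\Lambda,\mathfrak p^\pm)$ is an $\Omega$-surface with fixed vectors $\mathfrak p^\pm$ such that $(\mathfrak s^\pm,\mathfrak p^\pm)=0$; the plane $\Pi=\langle\mathfrak p^+,\mathfrak p^-\rangle$ is spanned by a unit timelike vector $\mathfrak p$ (point sphere complex) and a perpendicular vector $\mathfrak q$ (space form vector), defining the space form $\{\mathfrak v\in L^{4,1}:(\mathfrak v,\mathfrak p)=0,(\mathfrak v,\mathfrak q)=-1\}$ of curvature $\kappa=-(\mathfrak q,\mathfrak q)$, here $\kappa<0$. A 1-parameter subgroup of rotations is a 1-parameter group of orthogonal transformations fixing $\mathfrak p,\mathfrak q$ and acting as the identity on the orthogonal complement of a 2-plane $\Pi_1\perp\Pi$; it is parabolic if $\Pi_1$ has signature $(+0)$. $\Lambda$ is rotational if it is spanned by sphere congruences of the form $(\theta,t)\mapsto\rho_\theta c(t)$; then $s^\pm$ are rotational too. Adapted basis: $\Pi_1=\langle\mathfrak v,\mathfrak e_1\rangle$; the vectors $\mathfrak v,\mathfrak o$ are lightlike with $(\mathfrak v,\mathfrak o)=-1$; $\mathfrak e_1,\mathfrak e_2$ are orthogonal unit spacelike; $\mathfrak v,\mathfrak o$ are perpendicular to $\mathfrak e_1,\mathfrak e_2$, and all four are perpendicular to $\Pi$. For $i=1,2$ the parabolic rotation $\rho^i$ is $\mathfrak v\mapsto\mathfrak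 v$, $\mathfrak e_i\mapsto\mathfrak e_i+\theta\mathfrak v$, $\mathfrak o\mapsto\mathfrak o+\theta\mathfrak e_i+\frac{\theta^2}{2}\mathfrak v$, fixing the remaining basis vectors. Further $\kappa^\pm=(\mathfrak p^\pm,\mathfrak p^\pm)$, $\varepsilon=(\mathfrak p^+,\mathfrak p^-)$, $\Delta=\kappa^+\kappa^--\varepsilon^2\ (<0)$. The Christoffel dual lifts are fixed by $(\mathfrak s^\pm,\mathfrak p^\pm)=0$, $(\mathfrak s^\pm,\mathfrak p^\mp)=\Delta$. $r,\psi,d$ are functions of $t$ and $'$ is $d/dt$. *)

theory Defs
  imports "HOL-Analysis.Analysis" "HOL-Computational_Algebra.Polynomial"
begin

section \<open>Smooth maps\<close>

primrec Ck_on :: "nat \<Rightarrow> 'a::real_normed_vector set \<Rightarrow> ('a \<Rightarrow> 'b::real_normed_vector) \<Rightarrow> bool" where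
  "Ck_on 0 S f \<longleftrightarrow> continuous_on S f"
| "Ck_on (Suc k) S f \<longleftrightarrow>
     (\<forall>x\<in>S. f differentiable (at x)) \<and> (\<forall>h. Ck_on k S (\<lambda>x. frechet_derivative f (at x) h))"

text \<open>Meant for open sets \<open>S\<close> in a finite-dimensional space.\<close>

definition smooth_on :: "'a::real_normed_vector set \<Rightarrow> ('a \<Rightarrow> 'b::real_normed_vector) \<Rightarrow> bool" where
  "smooth_on S f \<longleftrightarrow> (\<forall>k. Ck_on k S f)"

definition du :: "(real \<times> real \<Rightarrow> 'b::real_normed_vector) \<Rightarrow> real \<times> real \<Rightarrow> 'b" where
  "du f x = frechet_derivative f (at x) (1, 0)"

definition dv :: "(real \<times> real \<Rightarrow> 'b::real_normed_vector) \<Rightarrow> real \<times> real \<Rightarrow> 'b" where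
  "dv f x = frechet_derivative f (at x) (0, 1)"


section \<open>Lie sphere geometry\<close>

type_synonym R42 = "(real^4) \<times> (real^2)"

definition lie_inner :: "R42 \<Rightarrow> R42 \<Rightarrow> real" (infix "\<bullet>\<^sub>L" 70) where
  "x \<bullet>\<^sub>L y = fst x \<bullet> fst y - snd x \<bullet> snd y"

definition lightlike_vectors :: "R42 set" where
  "lightlike_vectors = {x. x \<bullet>\<^sub>L x = 0}"

text \<open>Points of the projective space are represented as one-dimensional linear subspaces.\<close>

definition lie_quadric :: "R42 set set" where
  "lie_quadric = {span {x} | x. x \<noteq> 0 \<and> x \<in> lightlike_vectors}"

text \<open>
  The surface is an open subset \<open>S\<close> of the plane. Sphere congruences and Legendre maps are
  both given by assigning a linear subspace to each point.
\<close>

type_synonym subspace_map = "real \<times> real \<Rightarrow> R42 set"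

definition sections :: "(real \<times> real) set \<Rightarrow> subspace_map \<Rightarrow> (real \<times> real \<Rightarrow> R42) set" where
  "sections S L = {f. smooth_on S f \<and> (\<forall>x\<in>S. f x \<in> L x)}"

definition lifts :: "(real \<times> real) set \<Rightarrow> subspace_map \<Rightarrow> (real \<times> real \<Rightarrow> R42) set" where
  "lifts S s = {f. smooth_on S f \<and> (\<forall>x\<in>S. f x \<noteq> 0 \<and> f x \<in> lightlike_vectors \<and> span {f x} = s x)}"

text \<open>Smoothness of a map into the Lie quadric amounts to the existence of local smooth lifts.\<close>

definition sphere_congruence :: "(real \<times> real) set \<Rightarrow> subspace_map \<Rightarrow> bool" where
  "sphere_congruence S s \<longleftrightarrow> s ` S \<subseteq> lie_quadric \<and>
     (\<forall>x\<in>S. \<exists>N. open N \<and> x \<in> N \<and> N \<subseteq> S \<and> lifts N s \<noteq> {})"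

definition legendre_immersion :: "(real \<times> real) set \<Rightarrow> subspace_map \<Rightarrow> bool" where
  "legendre_immersion S L \<longleftrightarrow>
     (\<exists>f g. smooth_on S f \<and> smooth_on S g \<and>
        (\<forall>x\<in>S. L x = span {f x, g x} \<and> (\<forall>X. frechet_derivative f (at x) X \<bullet>\<^sub>L g x = 0))) \<and>
     (\<forall>x\<in>S. dim (L x) = 2 \<and> (\<forall>a\<in>L x. \<forall>b\<in>L x. a \<bullet>\<^sub>L b = 0)) \<and>
     (\<forall>x\<in>S. \<forall>X. (\<forall>f\<in>sections S L. frechet_derivative f (at x) X \<in> L x) \<longrightarrow> X = 0)"

definition envelopes :: "(real \<times> real) set \<Rightarrow> subspace_map \<Rightarrow> subspace_map \<Rightarrow> bool" where
  "envelopes S L s \<longleftrightarrow> sphere_congruence S s \<and> (\<forall>x\<in>S. s x \<subseteq> L x)"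

text \<open>Coordinates \<open>(u, v) \<in> W\<close> on a neighbourhood \<open>\<xi> ` W\<close> of \<open>x\<close>, given by the inverse \<open>\<xi>\<close> of the chart.\<close>

definition local_coordinates ::
  "(real \<times> real) set \<Rightarrow> real \<times> real \<Rightarrow> (real \<times> real) set \<Rightarrow> (real \<times> real \<Rightarrow> real \<times> real) \<Rightarrow> bool" where
  "local_coordinates S x W \<xi> \<longleftrightarrow>
     open W \<and> open (\<xi> ` W) \<and> x \<in> \<xi> ` W \<and> \<xi> ` W \<subseteq> S \<and>
     inj_on \<xi> W \<and> smooth_on W \<xi> \<and> smooth_on (\<xi> ` W) (inv_into W \<xi>)"

text \<open>
  The lifts range over all open subsets \<open>N\<close> of the coordinate neighbourhood, since lifts on the
  whole neighbourhood need not exist.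
\<close>

definition curvature_sphere_congruences ::
  "(real \<times> real) set \<Rightarrow> subspace_map \<Rightarrow> subspace_map \<Rightarrow> subspace_map \<Rightarrow> bool" where
  "curvature_sphere_congruences S L s1 s2 \<longleftrightarrow>
     envelopes S L s1 \<and> envelopes S L s2 \<and>
     (\<forall>x\<in>S. \<exists>W \<xi>. local_coordinates S x W \<xi> \<and>
        (\<forall>N. open N \<and> N \<subseteq> \<xi> ` W \<longrightarrow>
           (\<forall>f\<in>lifts N s1. \<forall>w\<in>W. \<xi> w \<in> N \<longrightarrow> du (f \<circ> \<xi>) w \<in> L (\<xi> w)) \<and>
           (\<forall>f\<in>lifts N s2. \<forall>w\<in>W. \<xi> w \<in> N \<longrightarrow> dv (f \<circ> \<xi>) w \<in> L (\<xi> w))))"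

definition isothermic :: "(real \<times> real) set \<Rightarrow> subspace_map \<Rightarrow> bool" where
  "isothermic S s \<longleftrightarrow> sphere_congruence S s \<and>
     (\<forall>x\<in>S. \<exists>W \<xi>. local_coordinates S x W \<xi> \<and>
        (\<exists>f\<in>lifts (\<xi> ` W) s. \<forall>w\<in>W. dv (du (f \<circ> \<xi>)) w \<in> span {f (\<xi> w)}))"

text \<open>Four points on a projective line whose cross-ratio is \<open>- 1\<close>.\<close>

definition separate_harmonically :: "R42 set \<Rightarrow> R42 set \<Rightarrow> R42 set \<Rightarrow> R42 set \<Rightarrow> bool" where
  "separate_harmonically m1 m2 l1 l2 \<longleftrightarrow>
     (\<exists>a b. a \<noteq> b \<and> independent {a, b} \<and> l1 = span {a} \<and> l2 = span {b} \<and>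
        m1 = span {a + b} \<and> m2 = span {a - b})"

text \<open>The pair \<open>sp\<close>, \<open>sm\<close> of isothermic sphere congruences is real here.\<close>

definition omega_surface ::
  "(real \<times> real) set \<Rightarrow> subspace_map \<Rightarrow> subspace_map \<Rightarrow> subspace_map \<Rightarrow> bool" where
  "omega_surface S L sp sm \<longleftrightarrow>
     legendre_immersion S L \<and>
     envelopes S L sp \<and> envelopes S L sm \<and> isothermic S sp \<and> isothermic S sm \<and>
     (\<exists>s1 s2. curvature_sphere_congruences S L s1 s2 \<and>
        (\<forall>x\<in>S. separate_harmonically (sp x) (sm x) (s1 x) (s2 x)))"

text \<open>
  Here \<open>(u, v)\<close> are the standard coordinates of the plane containing \<open>S\<close>. They are curvature
  line coordinates: \<open>fm - (C U / |fp\<^sub>u|\<^sup>2) fp\<close> and \<open>fm + (C V / |fp\<^sub>v|\<^sup>2) fp\<close> span the curvature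
  sphere congruences of the Legendre immersion spanned by \<open>fp\<close> and \<open>fm\<close>.
\<close>

definition christoffel_dual_lifts ::
  "(real \<times> real) set \<Rightarrow> subspace_map \<Rightarrow> subspace_map \<Rightarrow> real \<Rightarrow> (real \<Rightarrow> real) \<Rightarrow> (real \<Rightarrow> real) \<Rightarrow>
   (real \<times> real \<Rightarrow> R42) \<Rightarrow> (real \<times> real \<Rightarrow> R42) \<Rightarrow> bool" where
  "christoffel_dual_lifts S sp sm C U V fp fm \<longleftrightarrow>
     fp \<in> lifts S sp \<and> fm \<in> lifts S sm \<and>
     (\<forall>(u, v)\<in>S.
        du fp (u, v) \<bullet>\<^sub>L du fp (u, v) \<noteq> 0 \<and> dv fp (u, v) \<bullet>\<^sub>L dv fp (u, v) \<noteq> 0 \<and>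
        du fm (u, v) = (C * U u / (du fp (u, v) \<bullet>\<^sub>L du fp (u, v))) *\<^sub>R du fp (u, v) \<and>
        dv fm (u, v) = - (C * V v / (dv fp (u, v) \<bullet>\<^sub>L dv fp (u, v))) *\<^sub>R dv fp (u, v))"

text \<open>
  Sphere complexes \<open>pp\<close>, \<open>pm\<close>, point sphere complex \<open>p\<close> and space form vector \<open>q\<close>. Being
  perpendicular to \<open>pp\<close> resp. \<open>pm\<close> does not depend on the choice of lifts.
\<close>

definition linear_weingarten ::
  "(real \<times> real) set \<Rightarrow> subspace_map \<Rightarrow> subspace_map \<Rightarrow> subspace_map \<Rightarrow>
   R42 \<Rightarrow> R42 \<Rightarrow> R42 \<Rightarrow> R42 \<Rightarrow> bool" where
  "linear_weingarten S L sp sm pp pm p q \<longleftrightarrow>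
     omega_surface S L sp sm \<and>
     (\<forall>x\<in>S. (\<forall>y\<in>sp x. y \<bullet>\<^sub>L pp = 0) \<and> (\<forall>y\<in>sm x. y \<bullet>\<^sub>L pm = 0)) \<and>
     dim (span {pp, pm}) = 2 \<and> span {pp, pm} = span {p, q} \<and> p \<bullet>\<^sub>L p = - 1 \<and> p \<bullet>\<^sub>L q = 0"

definition space_form_curvature :: "R42 \<Rightarrow> real" where
  "space_form_curvature q = - (q \<bullet>\<^sub>L q)"


section \<open>Parabolic rotations\<close>

definition adapted_basis :: "R42 \<Rightarrow> R42 \<Rightarrow> R42 \<Rightarrow> R42 \<Rightarrow> R42 \<Rightarrow> R42 \<Rightarrow> bool" where
  "adapted_basis pp pm v e1 ov e2 \<longleftrightarrow>
     v \<bullet>\<^sub>L v = 0 \<and> ov \<bullet>\<^sub>L ov = 0 \<and> v \<bullet>\<^sub>L ov = - 1 \<and>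
     e1 \<bullet>\<^sub>L e1 = 1 \<and> e2 \<bullet>\<^sub>L e2 = 1 \<and> e1 \<bullet>\<^sub>L e2 = 0 \<and>
     (\<forall>x\<in>{v, ov}. \<forall>e\<in>{e1, e2}. x \<bullet>\<^sub>L e = 0) \<and>
     (\<forall>x\<in>{v, e1, ov, e2}. x \<bullet>\<^sub>L pp = 0 \<and> x \<bullet>\<^sub>L pm = 0)"

text \<open>The vectors in \<open>F\<close> are the remaining members of the basis.\<close>

definition parabolic_rotation :: "R42 set \<Rightarrow> R42 \<Rightarrow> R42 \<Rightarrow> R42 \<Rightarrow> (real \<Rightarrow> R42 \<Rightarrow> R42) \<Rightarrow> bool" where
  "parabolic_rotation F v e ov \<rho> \<longleftrightarrow>
     (\<forall>\<theta>. linear (\<rho> \<theta>) \<and> \<rho> \<theta> v = v \<and> \<rho> \<theta> e = e + \<theta> *\<^sub>R v \<and>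
        \<rho> \<theta> ov = ov + \<theta> *\<^sub>R e + (\<theta>\<^sup>2 / 2) *\<^sub>R v \<and> (\<forall>x\<in>F. \<rho> \<theta> x = x))"

definition rotational :: "real set \<Rightarrow> real set \<Rightarrow> (real \<Rightarrow> R42 \<Rightarrow> R42) \<Rightarrow> subspace_map \<Rightarrow> bool" where
  "rotational I J \<rho> L \<longleftrightarrow>
     (\<exists>c1 c2. smooth_on J c1 \<and> smooth_on J c2 \<and>
        (\<forall>t\<in>J. c1 t \<noteq> 0 \<and> c2 t \<noteq> 0 \<and> c1 t \<in> lightlike_vectors \<and> c2 t \<in> lightlike_vectors) \<and>
        (\<forall>\<theta>\<in>I. \<forall>t\<in>J. L (\<theta>, t) = span {\<rho> \<theta> (c1 t), \<rho> \<theta> (c2 t)}))"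

definition from_coords :: "R42 list \<Rightarrow> real list \<Rightarrow> R42" where
  "from_coords bs cs = (\<Sum>(c, b)\<leftarrow>zip cs bs. c *\<^sub>R b)"

end

theory Submission
  imports Defs
begin

text \<open>
  Fix an angle \<open>\<theta>\<close>. Differentiating the isotropy relations in \<open>\<theta>\<close> determines the components of
  \<open>fm\<close> along \<open>v\<close> and \<open>e1\<close> in terms of \<open>C / r\<close>. Let \<open>\<eta>\<close> be the component along the rotated vector
  \<open>\<rho>2 \<psi> e2\<close>. That \<open>fm\<close> is lightlike and perpendicular to \<open>fp\<close> gives
  \<open>\<eta>\<^sup>2 r\<^sup>4 = - \<Delta> p\<^sub>C(r\<^sup>2)\<close>, and that it is perpendicular to the \<open>t\<close>-derivative of \<open>fp\<close> gives
  \<open>r\<^sup>4 \<psi>' \<eta> = - \<Delta> r' (\<epsilon> r\<^sup>2 + \<kappa>p C)\<close>. Hence \<open>(r', \<psi>')\<close> is a multiple \<open>\<mu> (A, B)\<close> of the velocity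
  claimed in the theorem, where \<open>A\<close> is the smooth square root of the right-hand side supplied by \<open>\<eta>\<close>.
  The factor \<open>\<mu>\<close> is smooth and has no zeros since \<open>fp\<close> is immersed in the direction of \<open>t\<close>, so the
  inverse of an antiderivative of \<open>\<mu>\<close> is the required change of parameter.
\<close>

section \<open>Smooth functions of one variable\<close>

text \<open>Since \<open>S\<close> is open, agreement on \<open>S\<close> is agreement near each of
  its points, hence passes to the Frechet derivatives and, inductively, to all higher ones.\<close>

lemma Ck_on_cong:
  assumes "open S" "\<And>x. x \<in> S \<Longrightarrow> f x = g x"
  shows "Ck_on k S f \<longleftrightarrow> Ck_on k S g"
  using assms(2)
proof (induction k arbitrary: f g)
  case 0
  then show ?case by (simp cong: continuous_on_cong)
next
  case (Suc k)
  have *: "(f has_derivative f') (at x) \<longleftrightarrow> (g has_derivative f') (at x)" if "x \<in> S" for x f'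
    using has_derivative_transform_within_open[OF _ assms(1) that, of f f' UNIV g]
      has_derivative_transform_within_open[OF _ assms(1) that, of g f' UNIV f] Suc.prems
    by auto
  have fd: "frechet_derivative f (at x) = frechet_derivative g (at x)" if "x \<in> S" for x
    unfolding frechet_derivative_def using *[OF that] by simp
  have "Ck_on k S (\<lambda>x. frechet_derivative f (at x) h) \<longleftrightarrow>
      Ck_on k S (\<lambda>x. frechet_derivative g (at x) h)" for h
    using fd by (intro Suc.IH) simp
  moreover have "f differentiable (at x) \<longleftrightarrow> g differentiable (at x)" if "x \<in> S" for x
    using *[OF that] by (auto simp: differentiable_def)
  ultimately show ?case by simp
qed

lemma Ck_on_SucD: "Ck_on (Suc k) S f \<Longrightarrow> Ck_on k S f"
proof (induction k arbitrary: f)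
  case 0
  then show ?case
    by (auto intro!: continuous_at_imp_continuous_on differentiable_imp_continuous_within)
next
  case (Suc k)
  then show ?case by (metis Ck_on.simps(2))
qed

lemma Ck_on_0: "Ck_on k S (\<lambda>x. 0)"
  by (induction k) (simp_all)

lemma Ck_on_const: "Ck_on k S (\<lambda>x. c)"
  by (cases k) (simp_all add: Ck_on_0)

text \<open>Precedes the general product rule because the passage to ordinary derivatives rests on
  it: in direction \<open>h\<close> the Frechet derivative is \<open>h\<close> times the ordinary
  one.\<close>

lemma Ck_on_cmult:
  fixes f :: "'a::real_normed_vector \<Rightarrow> real"
  assumes "open S"
  shows "Ck_on k S f \<Longrightarrow> Ck_on k S (\<lambda>x. c * f x)"
proof (induction k arbitrary: f)
  case 0
  then show ?case by (simp add: continuous_intros)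
next
  case (Suc k)
  have d: "((\<lambda>x. c * f x) has_derivative (\<lambda>h. c * frechet_derivative f (at x) h)) (at x)"
    if "x \<in> S" for x
    using Suc.prems that by (auto intro!: derivative_eq_intros simp: frechet_derivative_works)
  have "Ck_on k S (\<lambda>x. frechet_derivative (\<lambda>x. c * f x) (at x) h) \<longleftrightarrow>
      Ck_on k S (\<lambda>x. c * frechet_derivative f (at x) h)" for h
    using frechet_derivative_at[OF d] by (intro Ck_on_cong[OF assms]) metis
  with Suc d show ?case by (auto simp: differentiable_def)
qed

text \<open>With its converse \<open>Ck_on_real_SucD\<close>, this trades directional Frechet
  derivatives for ordinary ones, so that the closure properties follow by induction on
  \<open>k\<close> from the rules of one-variable calculus.\<close>

lemma Ck_on_real_SucI:
  fixes f :: "real \<Rightarrow> real"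
  assumes "open S" "\<And>x. x \<in> S \<Longrightarrow> (f has_real_derivative f' x) (at x)" "Ck_on k S f'"
  shows "Ck_on (Suc k) S f"
proof -
  have d: "(f has_derivative (\<lambda>h. f' x * h)) (at x)" if "x \<in> S" for x
    using assms(2)[OF that] by (simp add: has_field_derivative_def)
  have "Ck_on k S (\<lambda>x. frechet_derivative f (at x) h)" for h
  proof -
    have "Ck_on k S (\<lambda>x. frechet_derivative f (at x) h) \<longleftrightarrow> Ck_on k S (\<lambda>x. h * f' x)"
      using frechet_derivative_at[OF d] by (intro Ck_on_cong[OF assms(1)]) (metis mult.commute)
    then show ?thesis using Ck_on_cmult[OF assms(1,3)] by simp
  qed
  with d show ?thesis by (auto simp: differentiable_def)
qed

lemma Ck_on_real_SucD:
  fixes f :: "real \<Rightarrow> real"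
  assumes "open S" "Ck_on (Suc k) S f"
  shows "\<And>x. x \<in> S \<Longrightarrow> (f has_real_derivative deriv f x) (at x)" "Ck_on k S (deriv f)"
proof -
  show 1: "(f has_real_derivative deriv f x) (at x)" if "x \<in> S" for x
    using assms(2) that DERIV_deriv_iff_real_differentiable by auto
  have "Ck_on k S (\<lambda>x. frechet_derivative f (at x) 1) \<longleftrightarrow> Ck_on k S (deriv f)"
    using 1 by (intro Ck_on_cong[OF assms(1)])
      (metis frechet_derivative_at has_field_derivative_def mult.right_neutral)
  then show "Ck_on k S (deriv f)" using assms(2) by simp
qed

lemma Ck_on_add:
  fixes f g :: "real \<Rightarrow> real"
  assumes "open S"
  shows "Ck_on k S f \<Longrightarrow> Ck_on k S g \<Longrightarrow> Ck_on k S (\<lambda>x. f x + g x)"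
proof (induction k arbitrary: f g)
  case 0
  then show ?case by (simp add: continuous_intros)
next
  case (Suc k)
  note f = Ck_on_real_SucD[OF assms Suc.prems(1)] and g = Ck_on_real_SucD[OF assms Suc.prems(2)]
  show ?case
    by (rule Ck_on_real_SucI[OF assms DERIV_add[OF f(1) g(1)] Suc.IH[OF f(2) g(2)]])
qed

lemma Ck_on_mult:
  fixes f g :: "real \<Rightarrow> real"
  assumes "open S"
  shows "Ck_on k S f \<Longrightarrow> Ck_on k S g \<Longrightarrow> Ck_on k S (\<lambda>x. f x * g x)"
proof (induction k arbitrary: f g)
  case 0
  then show ?case by (simp add: continuous_intros)
next
  case (Suc k)
  note f = Ck_on_real_SucD[OF assms Suc.prems(1)] and g = Ck_on_real_SucD[OF assms Suc.prems(2)]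
  show ?case
  proof (rule Ck_on_real_SucI[OF assms DERIV_mult[OF f(1) g(1)]])
    show "Ck_on k S (\<lambda>x. deriv f x * g x + deriv g x * f x)"
      by (intro Ck_on_add[OF assms] Suc.IH f(2) g(2) Ck_on_SucD[OF Suc.prems(1)]
          Ck_on_SucD[OF Suc.prems(2)])
  qed
qed

lemma Ck_on_power:
  fixes f :: "real \<Rightarrow> real"
  assumes "open S" "Ck_on k S f"
  shows "Ck_on k S (\<lambda>x. f x ^ n)"
  by (induction n) (simp_all add: Ck_on_const Ck_on_mult assms)

text \<open>The derivative is the product of \<open>- f'\<close> and the square of
  \<open>1 / f\<close>, and the induction hypothesis supplies \<open>1 / f\<close> at one order
  less.\<close>

lemma Ck_on_inverse:
  fixes f :: "real \<Rightarrow> real"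
  assumes "open S" "\<And>x. x \<in> S \<Longrightarrow> f x \<noteq> 0"
  shows "Ck_on k S f \<Longrightarrow> Ck_on k S (\<lambda>x. inverse (f x))"
proof (induction k)
  case 0
  then show ?case using assms by (auto intro!: continuous_intros)
next
  case (Suc k)
  note f = Ck_on_real_SucD[OF assms(1) Suc.prems]
  have "((\<lambda>x. inverse (f x)) has_real_derivative (- 1) * (deriv f x * (inverse (f x))^2)) (at x)"
    if "x \<in> S" for x
    using f(1)[OF that] assms(2)[OF that]
    by (auto intro!: derivative_eq_intros simp: power2_eq_square)
  then show ?case
  proof (rule Ck_on_real_SucI[OF assms(1)])
    show "Ck_on k S (\<lambda>x. (- 1) * (deriv f x * (inverse (f x))^2))"
      using Suc.IH[OF Ck_on_SucD[OF Suc.prems]]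
      by (intro Ck_on_cmult[OF assms(1)] Ck_on_mult[OF assms(1)] Ck_on_power[OF assms(1)] f(2))
  qed
qed

lemma Ck_on_compose:
  fixes f g :: "real \<Rightarrow> real"
  assumes "open S" "open T" "g ` S \<subseteq> T"
  shows "Ck_on k T f \<Longrightarrow> Ck_on k S g \<Longrightarrow> Ck_on k S (\<lambda>x. f (g x))"
proof (induction k arbitrary: f)
  case 0
  then show ?case using assms(3) continuous_on_compose2 by auto
next
  case (Suc k)
  note f = Ck_on_real_SucD[OF assms(2) Suc.prems(1)]
    and g = Ck_on_real_SucD[OF assms(1) Suc.prems(2)]
  have "((\<lambda>x. f (g x)) has_real_derivative deriv f (g x) * deriv g x) (at x)" if "x \<in> S" for x
    using DERIV_chain2[OF f(1) g(1)] assms(3) that by blast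
  then show ?case
  proof (rule Ck_on_real_SucI[OF assms(1)])
    show "Ck_on k S (\<lambda>x. deriv f (g x) * deriv g x)"
      by (rule Ck_on_mult[OF assms(1) Suc.IH[OF f(2) Ck_on_SucD[OF Suc.prems(2)]] g(2)])
  qed
qed

text \<open>The fundamental theorem of calculus, applied on a compact subinterval of
  \<open>J\<close> that has the given point in its interior.\<close>

lemma antiderivative_on_open_interval:
  fixes f :: "real \<Rightarrow> real"
  assumes "open J" "is_interval J" "continuous_on J f"
  shows "\<exists>F. \<forall>x\<in>J. (F has_real_derivative f x) (at x)"
proof (cases "J = {}")
  case False
  then obtain t0 where t0: "t0 \<in> J" by blast
  \<comment> \<open>An integral over an empty interval is 0, so this difference is the signed
    integral from \<open>t0\<close> to \<open>x\<close>.\<close>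
  define F where "F x = integral {t0..x} f - integral {x..t0} f" for x
  have "(F has_real_derivative f x) (at x)" if x: "x \<in> J" for x
  proof -
    have inner: "\<exists>e>0. cball y e \<subseteq> J" if "y \<in> J" for y
      using assms(1) that open_contains_cball by blast
    have mJ: "min x t0 \<in> J" "max x t0 \<in> J" using x t0 by (simp_all add: min_def max_def)
    obtain e where e: "e > 0" "cball (min x t0) e \<subseteq> J"
      using inner[OF mJ(1)] by blast
    obtain e' where e': "e' > 0" "cball (max x t0) e' \<subseteq> J"
      using inner[OF mJ(2)] by blast
    \<comment> \<open>The compact interval from \<open>a\<close> to \<open>b\<close> lies in
      \<open>J\<close> and has both \<open>x\<close> and \<open>t0\<close> in its interior. On it
      \<open>F\<close> differs by a constant from the integral that starts at
      \<open>a\<close>.\<close>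
    define a b where "a = min x t0 - e" and "b = max x t0 + e'"
    have ab: "a < x" "x < b" "a < t0" "t0 < b"
      unfolding a_def b_def using e(1) e'(1) by linarith+
    have "a \<in> cball (min x t0) e" "b \<in> cball (max x t0) e'"
      unfolding a_def b_def mem_cball dist_real_def using e(1) e'(1) by linarith+
    then have abJ: "a \<in> J" "b \<in> J" using e(2) e'(2) by blast+
    have sub: "{a..b} \<subseteq> J"
      by (rule subsetI, rule mem_is_interval_1_I[OF assms(2) abJ]) simp_all
    have cont: "continuous_on {a..b} f" using assms(3) sub continuous_on_subset by blast
    have int: "f integrable_on {c..d'}" if "a \<le> c" "d' \<le> b" for c d'
    proof (rule integrable_continuous_real[OF continuous_on_subset[OF cont]])
      show "{c..d'} \<subseteq> {a..b}" using that by simp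
    qed
    have F: "F y = integral {a..y} f - integral {a..t0} f" if "y \<in> {a..b}" for y
    proof (cases "t0 \<le> y")
      case True
      then have "integral {a..t0} f + integral {t0..y} f = integral {a..y} f"
        using that ab by (intro Henstock_Kurzweil_Integration.integral_combine int) simp_all
      moreover have "integral {y..t0} f = 0" using True by (cases "y = t0") auto
      ultimately show ?thesis by (simp add: F_def)
    next
      case False
      then have "integral {a..y} f + integral {y..t0} f = integral {a..t0} f"
        using that ab by (intro Henstock_Kurzweil_Integration.integral_combine int) simp_all
      moreover have "integral {t0..y} f = 0" using False by auto
      ultimately show ?thesis by (simp add: F_def)
    qed
    have "((\<lambda>y. integral {a..y} f) has_real_derivative f x) (at x within {a..b})"
      using cont ab by (intro integral_has_real_derivative) auto
    then have "((\<lambda>y. integral {a..y} f) has_real_derivative f x) (at x)"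
      using at_within_Icc_at[OF ab(1,2)] by simp
    then have "((\<lambda>y. integral {a..y} f - integral {a..t0} f) has_real_derivative f x) (at x)"
      by (auto intro!: derivative_eq_intros)
    then show ?thesis
    proof (rule has_field_derivative_transform_within_open[where S = "{a<..<b}"])
      show "integral {a..y} f - integral {a..t0} f = F y" if "y \<in> {a<..<b}" for y
        using F[of y] that by simp
    qed (use ab in simp_all)
  qed
  then show ?thesis by blast
qed simp

text \<open>\<open>\<phi>\<close> is the inverse of an antiderivative \<open>F\<close> of
  \<open>\<mu>\<close>. By the mean value theorem a repeated value of \<open>F\<close> would force a
  zero of \<open>\<mu>\<close>, so \<open>F\<close> is injective, and its image is an open interval.
  Smoothness is a bootstrap: \<open>\<phi>' = 1 / \<mu>(\<phi>)\<close> is as regular as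
  \<open>\<phi>\<close>, so each order of regularity yields the next.\<close>

lemma smooth_reparametrization:
  fixes \<mu> :: "real \<Rightarrow> real"
  assumes J: "open J" "is_interval J" and \<mu>: "smooth_on J \<mu>" and nz: "\<And>t. t \<in> J \<Longrightarrow> \<mu> t \<noteq> 0"
  shows "\<exists>J' \<phi>. open J' \<and> is_interval J' \<and> smooth_on J' \<phi> \<and> bij_betw \<phi> J' J \<and>
    (\<forall>t\<in>J'. (\<phi> has_real_derivative inverse (\<mu> (\<phi> t))) (at t))"
proof -
  have Ck: "Ck_on k J \<mu>" for k using \<mu> by (simp add: smooth_on_def)
  obtain F where F: "\<And>x. x \<in> J \<Longrightarrow> (F has_real_derivative \<mu> x) (at x)"
    using antiderivative_on_open_interval[OF J, of \<mu>] Ck[of 0] by auto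
  have cF: "continuous_on J F"
    by (meson DERIV_isCont F continuous_at_imp_continuous_on)
  have neq: "F a \<noteq> F b" if "a \<in> J" "b \<in> J" "a < b" for a b
  proof
    assume "F a = F b"
    have sub: "{a..b} \<subseteq> J" 
      by (rule subsetI, rule mem_is_interval_1_I[OF J(2) that(1,2)]) simp_all
    have "(F has_real_derivative \<mu> x) (at x)" if "a \<le> x" "x \<le> b" for x
      using F sub that by auto
    from MVT2[OF \<open>a < b\<close> this] obtain z where z: "a < z" "z < b" "F b - F a = (b - a) * \<mu> z"
      by blast
    moreover have "z \<in> J" using z(1,2) sub by auto
    ultimately show False using \<open>F a = F b\<close> that nz by simp
  qed
  have inj: "inj_on F J"
    by (rule inj_onI) (metis linorder_neqE_linordered_idom neq)
  define \<phi> where "\<phi> = inv_into J F"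
  define J' where "J' = F ` J"
  have oJ': "open J'"
    unfolding J'_def using injective_into_1d_imp_open_map_UNIV[OF J(1) cF inj] by simp
  have iJ': "is_interval J'"
    unfolding J'_def using connected_continuous_image[OF cF] J(2)
    by (simp add: is_interval_connected_1)
  have bij: "bij_betw \<phi> J' J"
    unfolding \<phi>_def J'_def using inj by (simp add: bij_betw_inv_into inj_on_imp_bij_betw)
  have der: "(\<phi> has_real_derivative inverse (\<mu> (\<phi> t))) (at t)" if "t \<in> J'" for t
  proof -
    have "\<phi> t \<in> J" using bij that bij_betwE by blast
    have "(\<phi> has_derivative (\<lambda>h. inverse (\<mu> (\<phi> t)) * h)) (at (F (\<phi> t)))"
    proof (rule has_derivative_inverse_strong[OF J(1) \<open>\<phi> t \<in> J\<close> cF])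
      show "\<phi> (F x) = x" if "x \<in> J" for x unfolding \<phi>_def using inj that by simp
      show "(F has_derivative (\<lambda>h. \<mu> (\<phi> t) * h)) (at (\<phi> t))"
        using F[OF \<open>\<phi> t \<in> J\<close>] by (simp add: has_field_derivative_def)
      show "(\<lambda>h. \<mu> (\<phi> t) * h) \<circ> (\<lambda>h. inverse (\<mu> (\<phi> t)) * h) = id"
        using nz[OF \<open>\<phi> t \<in> J\<close>] by (auto simp: fun_eq_iff)
    qed
    moreover have "F (\<phi> t) = t" using that by (simp add: \<phi>_def J'_def f_inv_into_f)
    ultimately show ?thesis by (simp add: has_field_derivative_def)
  qed
  have "Ck_on k J' \<phi>" for k
  proof (induction k)
    case 0
    then show ?case using der
      by (auto intro!: continuous_at_imp_continuous_on intro: DERIV_isCont)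
  next
    case (Suc k)
    have "Ck_on k J' (\<lambda>t. inverse (\<mu> (\<phi> t)))"
      using bij by (intro Ck_on_compose[OF oJ' J(1) _ _ Suc] Ck_on_inverse J(1) Ck nz)
        (auto simp: bij_betw_def)
    from Ck_on_real_SucI[OF oJ' der this] show ?case .
  qed
  then show ?thesis using oJ' iJ' bij der unfolding smooth_on_def by blast
qed

section \<open>The Lie inner product\<close>

text \<open>Identifies a Frechet derivative in a coordinate direction with the derivative along a
  coordinate line, where the product rule for curves is available.\<close>

lemma has_vector_derivative_du:
  assumes "f differentiable (at (x, y))"
  shows "((\<lambda>s. f (s, y)) has_vector_derivative du f (x, y)) (at x)"
proof -
  have "((\<lambda>s. (s, y)) has_derivative (\<lambda>h. (h, 0))) (at x)"
    by (auto intro!: derivative_eq_intros)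
  then have "((\<lambda>s. f (s, y)) has_derivative (\<lambda>h. frechet_derivative f (at (x, y)) (h, 0))) (at x)"
    by (rule has_derivative_compose) (use assms frechet_derivative_works in blast)
  moreover have "frechet_derivative f (at (x, y)) (h, 0) = h *\<^sub>R du f (x, y)" for h
    using linear_cmul[OF linear_frechet_derivative[OF assms], of h "(1, 0)"] by (simp add: du_def)
  ultimately show ?thesis by (simp add: has_vector_derivative_def)
qed

lemma has_vector_derivative_dv:
  assumes "f differentiable (at (x, y))"
  shows "((\<lambda>s. f (x, s)) has_vector_derivative dv f (x, y)) (at y)"
proof -
  have "((\<lambda>s. (x, s)) has_derivative (\<lambda>h. (0, h))) (at y)"
    by (auto intro!: derivative_eq_intros)
  then have "((\<lambda>s. f (x, s)) has_derivative (\<lambda>h. frechet_derivative f (at (x, y)) (0, h))) (at y)"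
    by (rule has_derivative_compose) (use assms frechet_derivative_works in blast)
  moreover have "frechet_derivative f (at (x, y)) (0, h) = h *\<^sub>R dv f (x, y)" for h
    using linear_cmul[OF linear_frechet_derivative[OF assms], of h "(0, 1)"] by (simp add: dv_def)
  ultimately show ?thesis by (simp add: has_vector_derivative_def)
qed

text \<open>Flipping the sign of the two timelike coordinates of one argument turns the form into
  the Euclidean inner product, from which boundedness is inherited.\<close>

interpretation lie: bounded_bilinear lie_inner
proof -
  have "bounded_linear (\<lambda>x::R42. (fst x, - snd x))"
    by (intro bounded_linear_Pair bounded_linear_minus bounded_linear_fst bounded_linear_snd)
  from bounded_bilinear.comp1[OF bounded_bilinear_inner this]
  have "bounded_bilinear (\<lambda>(x::R42) y. (fst x, - snd x) \<bullet> y)" .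
  moreover have "lie_inner = (\<lambda>x y. (fst x, - snd x) \<bullet> y)"
    by (simp add: lie_inner_def fun_eq_iff inner_prod_def)
  ultimately show "bounded_bilinear lie_inner" by simp
qed

lemma lie_inner_commute: "x \<bullet>\<^sub>L y = y \<bullet>\<^sub>L x"
  by (simp add: lie_inner_def inner_commute)

lemma lie_inner_has_real_derivative:
  assumes "(f has_vector_derivative f') (at x)" "(g has_vector_derivative g') (at x)"
  shows "((\<lambda>x. f x \<bullet>\<^sub>L g x) has_real_derivative (f x \<bullet>\<^sub>L g' + f' \<bullet>\<^sub>L g x)) (at x)"
  using lie.has_vector_derivative[OF assms]
  by (simp add: has_real_derivative_iff_has_vector_derivative)

text \<open>Serves to show that components of \<open>fm\<close> along fixed vectors are smooth in
  \<open>t\<close>. The induction varies \<open>f\<close>, since its step passes to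
  \<open>dv f\<close>.\<close>

lemma Ck_on_slice_lie_inner:
  fixes I J :: "real set"
  assumes "open I" "open J" "\<theta> \<in> I"
  shows "Ck_on k (I \<times> J) f \<Longrightarrow> Ck_on k J (\<lambda>t. f (\<theta>, t) \<bullet>\<^sub>L a)"
proof (induction k arbitrary: f)
  case 0
  have "continuous_on J (\<lambda>t. f (\<theta>, t))"
  proof (rule continuous_on_compose2[of "I \<times> J" f])
    show "continuous_on J (\<lambda>t. (\<theta>, t))" by (intro continuous_intros)
  qed (use 0 assms(3) in auto)
  from lie.continuous_on[OF this continuous_on_const] show ?case by simp
next
  case (Suc k)
  have "((\<lambda>t. f (\<theta>, t) \<bullet>\<^sub>L a) has_real_derivative dv f (\<theta>, t) \<bullet>\<^sub>L a) (at t)" if "t \<in> J" for t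
  proof -
    have "f differentiable (at (\<theta>, t))" using Suc.prems assms(3) that by simp
    from lie_inner_has_real_derivative[OF has_vector_derivative_dv[OF this] has_vector_derivative_const]
    show ?thesis by (simp add: lie.zero_right)
  qed
  moreover have "Ck_on k J (\<lambda>t. dv f (\<theta>, t) \<bullet>\<^sub>L a)"
  proof (rule Suc.IH[of "dv f"])
    show "Ck_on k (I \<times> J) (dv f)" using Suc.prems unfolding dv_def[abs_def] Ck_on.simps(2) by blast
  qed
  ultimately show ?case by (rule Ck_on_real_SucI[OF assms(2)])
qed

lemma lie_inner_zero_derivative:
  assumes "open I" "x \<in> I" "(f has_vector_derivative f') (at x)" "(g has_vector_derivative g') (at x)"
    and "\<And>s. s \<in> I \<Longrightarrow> f s \<bullet>\<^sub>L g s = 0"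
  shows "f x \<bullet>\<^sub>L g' + f' \<bullet>\<^sub>L g x = 0"
proof -
  have "((\<lambda>s. 0) has_real_derivative f x \<bullet>\<^sub>L g' + f' \<bullet>\<^sub>L g x) (at x)"
    by (rule has_field_derivative_transform_within_open
        [OF lie_inner_has_real_derivative[OF assms(3,4)] assms(1,2) assms(5)])
  then show ?thesis using DERIV_unique DERIV_const by blast
qed

text \<open>A change of basis multiplies a Gram determinant by the square of its determinant, and
  the Gram determinant of \<open>p\<close>, \<open>q\<close> is \<open>- (q, q)\<close>. In
  hyperbolic space forms \<open>q\<close> is spacelike, which makes it negative.\<close>

lemma gram_det_neg:
  assumes "dim (span {pp, pm}) = 2" "span {pp, pm} = span {p, q}"
    and "p \<bullet>\<^sub>L p = - 1" "p \<bullet>\<^sub>L q = 0" "q \<bullet>\<^sub>L q > 0"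
  shows "(pp \<bullet>\<^sub>L pp) * (pm \<bullet>\<^sub>L pm) - (pp \<bullet>\<^sub>L pm)\<^sup>2 < 0"
proof -
  have span: "\<exists>a b. z = a *\<^sub>R p + b *\<^sub>R q" if z: "z \<in> span {p, q}" for z
  proof -
    obtain a where "z - a *\<^sub>R p \<in> span {q}"
      using z span_breakdown_eq[of z p "{q}"] by blast
    then obtain b where "z - a *\<^sub>R p = b *\<^sub>R q"
      by (auto simp: span_singleton)
    then have "z = a *\<^sub>R p + b *\<^sub>R q" by (simp add: diff_eq_eq add.commute)
    then show ?thesis by blast
  qed
  have "pp \<in> span {p, q}" "pm \<in> span {p, q}"
    using assms(2) span_base[of _ "{pp, pm}"] by auto
  then obtain a b c d where ab: "pp = a *\<^sub>R p + b *\<^sub>R q" and cd: "pm = c *\<^sub>R p + d *\<^sub>R q"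
    using span by meson
  have "a * d - b * c \<noteq> 0"
  proof
    assume 0: "a * d - b * c = 0"
    have "dim {pp, pm} \<le> 1"
    proof -
      have "d *\<^sub>R pp = b *\<^sub>R pm" "c *\<^sub>R pp = a *\<^sub>R pm"
        using 0 by (auto simp: ab cd scaleR_add_right mult.commute)
      \<comment> \<open>Unless \<open>pm\<close> vanishes, \<open>c\<close> or \<open>d\<close> is
        nonzero, and the corresponding one of the two relations exhibits \<open>pp\<close> as a
        multiple of \<open>pm\<close>.\<close>
      have "\<exists>w. {pp, pm} \<subseteq> span {w}"
      proof (cases "pm = 0")
        case True
        then show ?thesis by (intro exI[of _ pp]) (auto intro: span_base span_zero)
      next
        case False
        then have "c \<noteq> 0 \<or> d \<noteq> 0" using cd by auto
        then have "\<exists>k. pp = k *\<^sub>R pm"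
        proof
          assume "c \<noteq> 0"
          then have "pp = (a / c) *\<^sub>R pm"
            using arg_cong[OF \<open>c *\<^sub>R pp = a *\<^sub>R pm\<close>, of "\<lambda>z. inverse c *\<^sub>R z"]
            by (simp add: field_simps)
          then show ?thesis by blast
        next
          assume "d \<noteq> 0"
          then have "pp = (b / d) *\<^sub>R pm"
            using arg_cong[OF \<open>d *\<^sub>R pp = b *\<^sub>R pm\<close>, of "\<lambda>z. inverse d *\<^sub>R z"]
            by (simp add: field_simps)
          then show ?thesis by blast
        qed
        then show ?thesis by (intro exI[of _ pm]) (auto intro: span_base span_mul)
      qed
      then obtain w where w: "{pp, pm} \<subseteq> span {w}" by blast
      have "card {w} = 1" by simp
      then show ?thesis using dim_le_card[OF w] by simp
    qed
    with assms(1) show False by (simp add: dim_span)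
  qed
  then have "(a * d - b * c)\<^sup>2 * (q \<bullet>\<^sub>L q) > 0" using assms(5) by simp
  moreover have "(pp \<bullet>\<^sub>L pp) * (pm \<bullet>\<^sub>L pm) - (pp \<bullet>\<^sub>L pm)\<^sup>2 = - ((a * d - b * c)\<^sup>2 * (q \<bullet>\<^sub>L q))"
    using assms(3,4) lie_inner_commute[of q p] unfolding ab cd
    by (simp add: lie.add_left lie.add_right lie.scaleR_left lie.scaleR_right
        power2_eq_square algebra_simps)
  ultimately show ?thesis by simp
qed

text \<open>Expands \<open>x\<close> in the adapted basis. The first term comes from the inverse of
  the Gram matrix of \<open>pp\<close>, \<open>pm\<close>, the mixed term from the null pair
  \<open>v\<close>, \<open>ov\<close>.\<close>

lemma lie_inner_adapted_basis:
  assumes basis: "adapted_basis pp pm v e1 ov e2"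
    and \<Delta>: "\<Delta> = (pp \<bullet>\<^sub>L pp) * (pm \<bullet>\<^sub>L pm) - (pp \<bullet>\<^sub>L pm)\<^sup>2" "\<Delta> \<noteq> 0"
  shows "x \<bullet>\<^sub>L x =
    ((pm \<bullet>\<^sub>L pm) * (x \<bullet>\<^sub>L pp)\<^sup>2 - 2 * (pp \<bullet>\<^sub>L pm) * (x \<bullet>\<^sub>L pp) * (x \<bullet>\<^sub>L pm) + (pp \<bullet>\<^sub>L pp) * (x \<bullet>\<^sub>L pm)\<^sup>2) / \<Delta>
    - 2 * (x \<bullet>\<^sub>L v) * (x \<bullet>\<^sub>L ov) + (x \<bullet>\<^sub>L e1)\<^sup>2 + (x \<bullet>\<^sub>L e2)\<^sup>2"
proof -
  note bilin = lie.add_left lie.add_right lie.scaleR_left lie.scaleR_right lie.diff_left lie.diff_right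
  note b = basis[unfolded adapted_basis_def]
  have com: "pm \<bullet>\<^sub>L pp = pp \<bullet>\<^sub>L pm" "ov \<bullet>\<^sub>L v = v \<bullet>\<^sub>L ov" "e2 \<bullet>\<^sub>L e1 = e1 \<bullet>\<^sub>L e2"
    "e1 \<bullet>\<^sub>L v = v \<bullet>\<^sub>L e1" "e2 \<bullet>\<^sub>L v = v \<bullet>\<^sub>L e2" "e1 \<bullet>\<^sub>L ov = ov \<bullet>\<^sub>L e1" "e2 \<bullet>\<^sub>L ov = ov \<bullet>\<^sub>L e2"
    by (rule lie_inner_commute)+
  have com': "pp \<bullet>\<^sub>L z = z \<bullet>\<^sub>L pp" "pm \<bullet>\<^sub>L z = z \<bullet>\<^sub>L pm" if "z \<in> {v, e1, ov, e2}" for z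
    by (rule lie_inner_commute)+
  \<comment> \<open>\<open>\<Phi>\<close> records the inner products with the basis, and
    \<open>\<Psi>\<close> rebuilds a vector from them.\<close>
  define \<Phi> where "\<Phi> y = (y \<bullet>\<^sub>L pp, y \<bullet>\<^sub>L pm, y \<bullet>\<^sub>L v, y \<bullet>\<^sub>L e1, y \<bullet>\<^sub>L ov, y \<bullet>\<^sub>L e2)" for y
  define \<Psi> where "\<Psi> = (\<lambda>(a, b, c, d, e, f).
    (((pm \<bullet>\<^sub>L pm) * a - (pp \<bullet>\<^sub>L pm) * b) / \<Delta>) *\<^sub>R pp +
    (((pp \<bullet>\<^sub>L pp) * b - (pp \<bullet>\<^sub>L pm) * a) / \<Delta>) *\<^sub>R pm - e *\<^sub>R v + d *\<^sub>R e1 - c *\<^sub>R ov + f *\<^sub>R e2)"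
  have lin: "linear \<Phi>" by (rule linearI) (simp_all add: \<Phi>_def bilin)
  have \<Phi>\<Psi>: "\<Phi> (\<Psi> z) = z" for z
  proof -
    obtain a1 a2 a3 a4 a5 a6 where z: "z = (a1, a2, a3, a4, a5, a6)" by (cases z)
    have "((pm \<bullet>\<^sub>L pm) * a1 - (pp \<bullet>\<^sub>L pm) * a2) / \<Delta> * (pp \<bullet>\<^sub>L pp) +
        ((pp \<bullet>\<^sub>L pp) * a2 - (pp \<bullet>\<^sub>L pm) * a1) / \<Delta> * (pp \<bullet>\<^sub>L pm) = \<Delta> * a1 / \<Delta>"
      "((pm \<bullet>\<^sub>L pm) * a1 - (pp \<bullet>\<^sub>L pm) * a2) / \<Delta> * (pp \<bullet>\<^sub>L pm) +
        ((pp \<bullet>\<^sub>L pp) * a2 - (pp \<bullet>\<^sub>L pm) * a1) / \<Delta> * (pm \<bullet>\<^sub>L pm) = \<Delta> * a2 / \<Delta>"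
      unfolding \<Delta>(1) times_divide_eq_left add_divide_distrib[symmetric]
      by (simp_all add: algebra_simps power2_eq_square)
    then show ?thesis
      using b com com' \<Delta>(2) by (simp add: z \<Phi>_def \<Psi>_def bilin)
  qed
  \<comment> \<open>The right inverse \<open>\<Psi>\<close> makes \<open>\<Phi>\<close> surjective.
    Both spaces have dimension six, so it is injective as well, and the adapted basis indeed
    spans.\<close>
  have "inj \<Phi>"
    by (rule linear_surjective_imp_injective[OF lin surjI]) (rule \<Phi>\<Psi>, simp add: dim_UNIV)
  then have x: "x = \<Psi> (\<Phi> x)" using \<Phi>\<Psi>[of "\<Phi> x"] by (simp add: inj_eq)
  have "x \<bullet>\<^sub>L x = x \<bullet>\<^sub>L \<Psi> (\<Phi> x)" using x by simp
  also have "\<dots> = (((pm \<bullet>\<^sub>L pm) * (x \<bullet>\<^sub>L pp) - (pp \<bullet>\<^sub>L pm) * (x \<bullet>\<^sub>L pm)) / \<Delta>) * (x \<bullet>\<^sub>L pp) +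
    (((pp \<bullet>\<^sub>L pp) * (x \<bullet>\<^sub>L pm) - (pp \<bullet>\<^sub>L pm) * (x \<bullet>\<^sub>L pp)) / \<Delta>) * (x \<bullet>\<^sub>L pm)
    - (x \<bullet>\<^sub>L ov) * (x \<bullet>\<^sub>L v) + (x \<bullet>\<^sub>L e1) * (x \<bullet>\<^sub>L e1) - (x \<bullet>\<^sub>L v) * (x \<bullet>\<^sub>L ov) + (x \<bullet>\<^sub>L e2) * (x \<bullet>\<^sub>L e2)"
    unfolding \<Psi>_def \<Phi>_def prod.case bilin by simp
  finally show ?thesis
    by (simp add: diff_divide_distrib add_divide_distrib algebra_simps power2_eq_square)
qed

section \<open>The profile curve\<close>

text \<open>
  For \<open>\<delta>\<close>, \<open>X\<close> the inner products of \<open>fm\<close> with \<open>e2\<close>, \<open>ov\<close>, the assumptions say that \<open>fm\<close> is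
  lightlike and perpendicular to \<open>fp\<close> and to its \<open>t\<close>-derivative.
\<close>

lemma dual_lift_equations:
  fixes r \<psi> \<delta> X \<theta> C \<kappa>p \<kappa>m \<epsilon> \<Delta> r' \<psi>' :: real
  assumes r: "r \<noteq> 0"
    and null: "\<kappa>m * \<Delta> + 2 * (C / r) * X + (\<theta> * (C / r))\<^sup>2 + \<delta>\<^sup>2 = 0"
    and iso: "- \<epsilon> * \<Delta> - (\<kappa>p * \<Delta> / (2 * r) + r * (\<psi>\<^sup>2 + \<theta>\<^sup>2) / 2) * (C / r) + r * \<theta> * (\<theta> * (C / r))
      + r * \<psi> * \<delta> + r * X = 0"
    and orth: "- (- \<kappa>p * \<Delta> * r' / (2 * r\<^sup>2) + r' * (\<psi>\<^sup>2 + \<theta>\<^sup>2) / 2 + r * \<psi> * \<psi>') * (C / r)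
      + r' * \<theta> * (\<theta> * (C / r)) + (r' * \<psi> + r * \<psi>') * \<delta> + r' * X = 0"
    and \<eta>: "\<eta> = \<delta> - \<psi> * (C / r)"
  shows "\<eta>\<^sup>2 * r ^ 4 = - \<Delta> * (\<kappa>m * r ^ 4 + 2 * C * \<epsilon> * r\<^sup>2 + \<kappa>p * C\<^sup>2)"
    and "r ^ 4 * \<psi>' * \<eta> = - \<Delta> * r' * (\<epsilon> * r\<^sup>2 + \<kappa>p * C)"
proof -
  define c where "c = C / r"
  define m where "m = inverse r"
  have C: "C = c * r" and mr: "m * r = 1" and \<delta>: "\<delta> = \<eta> + \<psi> * c"
    using r \<eta> by (auto simp: c_def m_def)
  \<comment> \<open>The orthogonality of the two lifts is solved for \<open>X\<close>; in terms of
    \<open>m\<close> and \<open>c\<close> the result is free of denominators.\<close>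
  have "m * (r * X) = m * (\<epsilon> * \<Delta> + (\<kappa>p * \<Delta> * m / 2 + r * (\<psi>\<^sup>2 + \<theta>\<^sup>2) / 2) * c - r * \<theta> * (\<theta> * c) - r * \<psi> * \<delta>)"
    by (rule arg_cong[where f = "(*) m"]) (use iso in \<open>simp add: c_def[symmetric] m_def field_simps\<close>)
  also have "\<dots> = m * \<epsilon> * \<Delta> + \<kappa>p * \<Delta> * m\<^sup>2 * c / 2
      + (m * r) * ((\<psi>\<^sup>2 + \<theta>\<^sup>2) * c / 2 - \<theta>\<^sup>2 * c - \<psi> * \<delta>)"
    by (simp add: algebra_simps power2_eq_square)
  finally have X: "X = m * \<epsilon> * \<Delta> + \<kappa>p * \<Delta> * m\<^sup>2 * c / 2 + (\<psi>\<^sup>2 + \<theta>\<^sup>2) * c / 2 - \<theta>\<^sup>2 * c - \<psi> * \<delta>"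
    unfolding mult.assoc[symmetric] mr by simp
  have null': "\<kappa>m * \<Delta> + 2 * c * X + (\<theta> * c)\<^sup>2 + \<delta>\<^sup>2 = 0" using null by (simp add: c_def)
  have orth': "- (- \<kappa>p * \<Delta> * r' * m\<^sup>2 / 2 + r' * (\<psi>\<^sup>2 + \<theta>\<^sup>2) / 2 + r * \<psi> * \<psi>') * c
      + r' * \<theta> * (\<theta> * c) + (r' * \<psi> + r * \<psi>') * \<delta> + r' * X = 0"
  proof -
    have "- \<kappa>p * \<Delta> * r' * m\<^sup>2 / 2 = - \<kappa>p * \<Delta> * r' / (2 * r\<^sup>2)"
      using r by (simp add: m_def field_simps)
    with orth show ?thesis unfolding c_def by (simp only:)
  qed
  \<comment> \<open>After inserting \<open>X\<close> the terms in \<open>\<theta>\<close> cancel,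
    and those in \<open>\<psi>\<close> and \<open>\<delta>\<close> form the square of
    \<open>\<delta> - \<psi> c = \<eta>\<close>.\<close>
  have "\<eta>\<^sup>2 = - \<Delta> * (\<kappa>m + 2 * c * m * \<epsilon> + c\<^sup>2 * m\<^sup>2 * \<kappa>p)"
    using null' unfolding X \<delta> by (simp add: field_simps power2_eq_square)
  then show "\<eta>\<^sup>2 * r ^ 4 = - \<Delta> * (\<kappa>m * r ^ 4 + 2 * C * \<epsilon> * r\<^sup>2 + \<kappa>p * C\<^sup>2)"
    using r unfolding c_def m_def by (simp add: field_simps eval_nat_numeral)
  have "r * \<psi>' * \<eta> = - \<Delta> * r' * m * (\<epsilon> + \<kappa>p * m * c)"
    using orth' unfolding X \<delta> by (simp add: field_simps power2_eq_square)
  then have "r ^ 3 * (r * \<psi>' * \<eta>) = r ^ 3 * (- \<Delta> * r' * m * (\<epsilon> + \<kappa>p * m * c))" by simp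
  also have "\<dots> = - \<Delta> * r' * (\<epsilon> * r\<^sup>2 + \<kappa>p * C)"
    using r unfolding c_def m_def by (simp add: field_simps eval_nat_numeral)
  finally show "r ^ 4 * \<psi>' * \<eta> = - \<Delta> * r' * (\<epsilon> * r\<^sup>2 + \<kappa>p * C)"
    by (simp add: eval_nat_numeral mult.assoc)
qed

text \<open>
  The quadratic form \<open>\<kappa>p \<Delta> x\<^sup>2 / r\<^sup>2 + r\<^sup>2 y\<^sup>2\<close>, which is the norm of the \<open>t\<close>-derivative of \<open>fp\<close> for
  \<open>(x, y) = (r', \<psi>')\<close>, takes the value \<open>r\<^sup>2\<close> at \<open>(A, B)\<close>. This makes \<open>\<mu>\<close>, obtained by pairing with
  \<open>(A, B)\<close>, the factor of proportionality; dividing \<open>r'\<close> by \<open>A\<close> instead would fail at the zeros of \<open>A\<close>.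
\<close>

lemma proportional_velocity:
  fixes r \<eta> C \<kappa>p \<kappa>m \<epsilon> \<Delta> r' \<psi>' :: real
  assumes r: "r \<noteq> 0" and \<Delta>: "\<Delta> = \<kappa>p * \<kappa>m - \<epsilon>\<^sup>2" "\<Delta> < 0"
    and eq1: "\<eta>\<^sup>2 * r ^ 4 = - \<Delta> * (\<kappa>m * r ^ 4 + 2 * C * \<epsilon> * r\<^sup>2 + \<kappa>p * C\<^sup>2)"
    and eq2: "r ^ 4 * \<psi>' * \<eta> = - \<Delta> * r' * (\<epsilon> * r\<^sup>2 + \<kappa>p * C)"
    and k: "k = sqrt (- 1 / \<Delta>)"
    and A: "A = k ^ 3 * (\<eta> * r\<^sup>2)"
    and B: "B = k * ((\<epsilon> * r\<^sup>2 + \<kappa>p * C) * (inverse r)\<^sup>2)"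
    and \<mu>: "\<mu> = (\<kappa>p * \<Delta> * (A * r' * (inverse r)\<^sup>2) + r\<^sup>2 * (B * \<psi>')) * (inverse r)\<^sup>2"
  shows "A\<^sup>2 = (\<kappa>m * r ^ 4 + 2 * C * \<epsilon> * r\<^sup>2 + \<kappa>p * C\<^sup>2) / \<Delta>\<^sup>2"
    and "r' = \<mu> * A" and "\<psi>' = \<mu> * B"
proof -
  define P where "P = \<kappa>m * r ^ 4 + 2 * C * \<epsilon> * r\<^sup>2 + \<kappa>p * C\<^sup>2"
  define w where "w = \<epsilon> * r\<^sup>2 + \<kappa>p * C"
  have Bw: "B = k * (w * (inverse r)\<^sup>2)" by (simp add: B w_def)
  have k2: "k\<^sup>2 = - 1 / \<Delta>" using \<Delta>(2) by (simp add: k)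
  have "A\<^sup>2 = (k\<^sup>2) ^ 3 * (\<eta>\<^sup>2 * r ^ 4)" by (simp add: A power_mult_distrib power_mult[symmetric])
  also have "\<dots> = P / \<Delta>\<^sup>2"
    unfolding eq1 k2 P_def[symmetric] using \<Delta>(2) by (simp add: field_simps eval_nat_numeral)
  finally show A2: "A\<^sup>2 = (\<kappa>m * r ^ 4 + 2 * C * \<epsilon> * r\<^sup>2 + \<kappa>p * C\<^sup>2) / \<Delta>\<^sup>2" by (simp add: P_def)
  \<comment> \<open>The velocities \<open>(r', \<psi>')\<close> and \<open>(A, B)\<close> are
    parallel.\<close>
  have "r\<^sup>2 * (\<psi>' * A) = k * k\<^sup>2 * (r ^ 4 * \<psi>' * \<eta>)" by (simp add: A eval_nat_numeral)
  also have "\<dots> = k * r' * w"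
    unfolding eq2 k2 w_def[symmetric] using \<Delta>(2) by simp
  also have "\<dots> = r\<^sup>2 * (r' * B)" using r by (simp add: Bw field_simps)
  finally have AB: "\<psi>' * A = r' * B" using r by simp
  \<comment> \<open>Completing the square in \<open>\<kappa>p P\<close> leaves only a multiple of
    \<open>r^4\<close>; this is why the quadratic form takes the value \<open>r\<^sup>2\<close> at
    \<open>(A, B)\<close>.\<close>
  have "\<kappa>p * P - w\<^sup>2 = \<Delta> * r ^ 4"
    by (simp add: P_def w_def \<Delta>(1) algebra_simps eval_nat_numeral)
  then have "(\<kappa>p * P - w\<^sup>2) / (\<Delta> * r\<^sup>2) = r\<^sup>2"
    using r \<Delta>(2) by (simp add: eval_nat_numeral)
  moreover have "\<kappa>p * \<Delta> * A\<^sup>2 * (inverse r)\<^sup>2 = \<kappa>p * P / (\<Delta> * r\<^sup>2)"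
    unfolding A2 P_def[symmetric] using r \<Delta>(2) by (simp add: field_simps power2_eq_square)
  moreover have "r\<^sup>2 * B\<^sup>2 = - w\<^sup>2 / (\<Delta> * r\<^sup>2)"
  proof -
    have "r\<^sup>2 * B\<^sup>2 = k\<^sup>2 * w\<^sup>2 * (inverse r)\<^sup>2"
      using r by (simp add: Bw field_simps eval_nat_numeral)
    then show ?thesis using r by (simp add: k2 field_simps)
  qed
  ultimately have norm: "\<kappa>p * \<Delta> * A\<^sup>2 * (inverse r)\<^sup>2 + r\<^sup>2 * B\<^sup>2 = r\<^sup>2"
    by (simp add: diff_divide_distrib)
  have "\<mu> * A = (\<kappa>p * \<Delta> * A\<^sup>2 * (inverse r)\<^sup>2 * r' + r\<^sup>2 * B * (\<psi>' * A)) * (inverse r)\<^sup>2"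
    by (simp add: \<mu> algebra_simps power2_eq_square)
  also have "\<dots> = (\<kappa>p * \<Delta> * A\<^sup>2 * (inverse r)\<^sup>2 + r\<^sup>2 * B\<^sup>2) * r' * (inverse r)\<^sup>2"
    unfolding AB by (simp add: algebra_simps power2_eq_square)
  finally show "r' = \<mu> * A" unfolding norm using r by (simp add: field_simps)
  have "\<mu> * B = (\<kappa>p * \<Delta> * A * (inverse r)\<^sup>2 * (r' * B) + r\<^sup>2 * B\<^sup>2 * \<psi>') * (inverse r)\<^sup>2"
    by (simp add: \<mu> algebra_simps power2_eq_square)
  also have "\<dots> = (\<kappa>p * \<Delta> * A\<^sup>2 * (inverse r)\<^sup>2 + r\<^sup>2 * B\<^sup>2) * \<psi>' * (inverse r)\<^sup>2"
    unfolding AB[symmetric] by (simp add: algebra_simps power2_eq_square)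
  finally show "\<psi>' = \<mu> * B" unfolding norm using r by (simp add: field_simps)
qed

text \<open>The discriminant is \<open>- 4 C\<^sup>2 \<Delta>\<close>, which is nonnegative because
  \<open>\<Delta> < 0\<close>. A factorization for all \<open>x\<close> also covers a double
  root.\<close>

lemma quadratic_roots:
  fixes C \<kappa>p \<kappa>m \<epsilon> \<Delta> :: real
  assumes "\<Delta> = \<kappa>p * \<kappa>m - \<epsilon>\<^sup>2" "\<Delta> < 0" "\<kappa>m \<noteq> 0"
  shows "\<exists>C1 C2. \<forall>x. \<kappa>m * x\<^sup>2 + 2 * C * \<epsilon> * x + \<kappa>p * C\<^sup>2 = \<kappa>m * (x - C1) * (x - C2)"
proof -
  define s where "s = sqrt (- \<Delta>)"
  have s: "s\<^sup>2 = \<epsilon>\<^sup>2 - \<kappa>p * \<kappa>m" using assms(1,2) by (simp add: s_def)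
  define C1 C2 where "C1 = C * (s - \<epsilon>) / \<kappa>m" and "C2 = C * (- s - \<epsilon>) / \<kappa>m"
  have sum: "\<kappa>m * (C1 + C2) = - 2 * C * \<epsilon>"
    using assms(3) by (simp add: C1_def C2_def field_simps)
  have "\<kappa>m * (C1 * C2) = C\<^sup>2 * (\<epsilon>\<^sup>2 - s\<^sup>2) / \<kappa>m"
    using assms(3) by (simp add: C1_def C2_def field_simps power2_eq_square)
  also have "\<dots> = \<kappa>p * C\<^sup>2" using assms(3) by (simp add: s)
  finally have prod: "\<kappa>m * (C1 * C2) = \<kappa>p * C\<^sup>2" .
  have "\<kappa>m * (x - C1) * (x - C2) = \<kappa>m * x\<^sup>2 - \<kappa>m * (C1 + C2) * x + \<kappa>m * (C1 * C2)" for x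
    by (simp add: algebra_simps power2_eq_square)
  then show ?thesis unfolding sum prod by (intro exI[of _ C1] exI[of _ C2]) simp
qed

theorem proposition3p5:
  fixes I J :: "real set"
    and L sp sm :: subspace_map
    and fp fm :: "real \<times> real \<Rightarrow> R42"
    and pp pm p q v e1 ov e2 :: R42
    and \<rho>1 \<rho>2 :: "real \<Rightarrow> R42 \<Rightarrow> R42"
    and r \<psi> d V :: "real \<Rightarrow> real"
    and C \<kappa>p \<kappa>m \<epsilon> \<Delta> :: real
  assumes I: "open I" "is_interval I" "I \<noteq> {}"
    and J: "open J" "is_interval J" "J \<noteq> {}"
    and lW: "linear_weingarten (I \<times> J) L sp sm pp pm p q"
    and hyperbolic: "space_form_curvature q < 0"
    and basis: "adapted_basis pp pm v e1 ov e2"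
    and \<rho>1: "parabolic_rotation {pp, pm, e2} v e1 ov \<rho>1"
    and \<rho>2: "parabolic_rotation {pp, pm, e1} v e2 ov \<rho>2"
    and rotational: "rotational I J \<rho>1 L"
    and \<kappa>p: "\<kappa>p = pp \<bullet>\<^sub>L pp" and \<kappa>m: "\<kappa>m = pm \<bullet>\<^sub>L pm"
    and \<epsilon>: "\<epsilon> = pp \<bullet>\<^sub>L pm" and \<Delta>: "\<Delta> = \<kappa>p * \<kappa>m - \<epsilon>\<^sup>2"
    and \<kappa>m_nonzero: "\<kappa>m \<noteq> 0"
    and christoffel: "christoffel_dual_lifts (I \<times> J) sp sm C (\<lambda>_. 1) V fp fm"
    and normalized: "\<And>x. x \<in> I \<times> J \<Longrightarrow> fp x \<bullet>\<^sub>L pp = 0 \<and> fp x \<bullet>\<^sub>L pm = \<Delta>"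
      "\<And>x. x \<in> I \<times> J \<Longrightarrow> fm x \<bullet>\<^sub>L pm = 0 \<and> fm x \<bullet>\<^sub>L pp = \<Delta>"
    and smooth: "smooth_on J r" "smooth_on J \<psi>" "smooth_on J d"
    and polar: "\<And>\<theta> t. \<theta> \<in> I \<Longrightarrow> t \<in> J \<Longrightarrow>
      fp (\<theta>, t) = \<rho>1 \<theta> (\<rho>2 (\<psi> t) (from_coords [pp, pm, v, e1, ov, e2] [- \<epsilon>, \<kappa>p, d t, 0, r t, 0]))"
  shows "\<exists>C1 C2 :: real. {x. poly [:\<kappa>p * C\<^sup>2, 2 * C * \<epsilon>, \<kappa>m:] x = 0} = {C1, C2} \<and>
    (\<exists>(J' :: real set) (\<phi> :: real \<Rightarrow> real).
      open J' \<and> is_interval J' \<and> smooth_on J' \<phi> \<and> bij_betw \<phi> J' J \<and> (\<forall>t\<in>J'. deriv \<phi> t \<noteq> 0) \<and>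
      (\<forall>t\<in>J'.
        (\<exists>r'. ((r \<circ> \<phi>) has_real_derivative r') (at t) \<and>
           r'\<^sup>2 = \<kappa>m / \<Delta>\<^sup>2 * ((r (\<phi> t))\<^sup>2 - C1) * ((r (\<phi> t))\<^sup>2 - C2)) \<and>
        ((\<psi> \<circ> \<phi>) has_real_derivative
           sqrt (- 1 / \<Delta>) * ((\<epsilon> * (r (\<phi> t))\<^sup>2 + \<kappa>p * C) / (r (\<phi> t))\<^sup>2)) (at t) \<and>
        d (\<phi> t) = \<kappa>p * \<Delta> / (2 * r (\<phi> t))))"
proof -

  \<comment> \<open>Signature of the plane of sphere complexes and inner products of the adapted
    basis\<close>
  note bilin = lie.add_left lie.add_right lie.scaleR_left lie.scaleR_right lie.diff_left lie.diff_right
    lie.minus_left lie.minus_right lie.zero_left lie.zero_right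
  have omega: "omega_surface (I \<times> J) L sp sm" and dim: "dim (span {pp, pm}) = 2"
    "span {pp, pm} = span {p, q}" "p \<bullet>\<^sub>L p = - 1" "p \<bullet>\<^sub>L q = 0"
    using lW unfolding linear_weingarten_def by blast+
  have \<Delta>neg: "\<Delta> < 0"
    using gram_det_neg[OF dim] hyperbolic by (simp add: space_form_curvature_def \<Delta> \<kappa>p \<kappa>m \<epsilon>)
  have b: "v \<bullet>\<^sub>L v = 0" "ov \<bullet>\<^sub>L ov = 0" "v \<bullet>\<^sub>L ov = - 1" "e1 \<bullet>\<^sub>L e1 = 1" "e2 \<bullet>\<^sub>L e2 = 1" "e1 \<bullet>\<^sub>L e2 = 0"
    "v \<bullet>\<^sub>L e1 = 0" "v \<bullet>\<^sub>L e2 = 0" "ov \<bullet>\<^sub>L e1 = 0" "ov \<bullet>\<^sub>L e2 = 0" "v \<bullet>\<^sub>L pp = 0" "v \<bullet>\<^sub>L pm = 0"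
    "e1 \<bullet>\<^sub>L pp = 0" "e1 \<bullet>\<^sub>L pm = 0" "ov \<bullet>\<^sub>L pp = 0" "ov \<bullet>\<^sub>L pm = 0" "e2 \<bullet>\<^sub>L pp = 0" "e2 \<bullet>\<^sub>L pm = 0"
    using basis by (simp_all add: adapted_basis_def)
  have b': "ov \<bullet>\<^sub>L v = - 1" "e2 \<bullet>\<^sub>L e1 = 0" "e1 \<bullet>\<^sub>L v = 0" "e2 \<bullet>\<^sub>L v = 0"
    "e1 \<bullet>\<^sub>L ov = 0" "e2 \<bullet>\<^sub>L ov = 0" "pp \<bullet>\<^sub>L v = 0" "pm \<bullet>\<^sub>L v = 0" "pp \<bullet>\<^sub>L e1 = 0"
    "pm \<bullet>\<^sub>L e1 = 0" "pp \<bullet>\<^sub>L ov = 0" "pm \<bullet>\<^sub>L ov = 0" "pp \<bullet>\<^sub>L e2 = 0" "pm \<bullet>\<^sub>L e2 = 0"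
    by (subst lie_inner_commute, rule b)+
  have gram: "pp \<bullet>\<^sub>L pp = \<kappa>p" "pm \<bullet>\<^sub>L pm = \<kappa>m" "pp \<bullet>\<^sub>L pm = \<epsilon>" "pm \<bullet>\<^sub>L pp = \<epsilon>"
    using \<kappa>p \<kappa>m \<epsilon> lie_inner_commute[of pm pp] by simp_all

  \<comment> \<open>Regularity and isotropy of the dual lifts\<close>
  have lifts: "fp \<in> lifts (I \<times> J) sp" "fm \<in> lifts (I \<times> J) sm"
    and chr: "\<And>\<theta> t. \<theta> \<in> I \<Longrightarrow> t \<in> J \<Longrightarrow> du fp (\<theta>, t) \<bullet>\<^sub>L du fp (\<theta>, t) \<noteq> 0 \<and>
        dv fp (\<theta>, t) \<bullet>\<^sub>L dv fp (\<theta>, t) \<noteq> 0 \<and>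
        du fm (\<theta>, t) = (C / (du fp (\<theta>, t) \<bullet>\<^sub>L du fp (\<theta>, t))) *\<^sub>R du fp (\<theta>, t) \<and>
        dv fm (\<theta>, t) = - (C * V t / (dv fp (\<theta>, t) \<bullet>\<^sub>L dv fp (\<theta>, t))) *\<^sub>R dv fp (\<theta>, t)"
    using christoffel unfolding christoffel_dual_lifts_def by auto
  have Ck_fm: "Ck_on n (I \<times> J) fm" and Ck_fp: "Ck_on n (I \<times> J) fp" for n
    using lifts by (simp_all add: lifts_def smooth_on_def)
  have diff: "fp differentiable (at (\<theta>, t))" "fm differentiable (at (\<theta>, t))"
    if "\<theta> \<in> I" "t \<in> J" for \<theta> t
    using Ck_fm[of "Suc 0"] Ck_fp[of "Suc 0"] that by simp_all
  have null: "fp (s, t) \<bullet>\<^sub>L fp (s, t) = 0" "fm (s, t) \<bullet>\<^sub>L fm (s, t) = 0"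
    and iso: "fp (s, t) \<bullet>\<^sub>L fm (s, t) = 0" if "s \<in> I" "t \<in> J" for s t
  proof -
    let ?x = "(s, t)"
    show "fp ?x \<bullet>\<^sub>L fp ?x = 0" "fm ?x \<bullet>\<^sub>L fm ?x = 0"
      using lifts that by (simp_all add: lifts_def lightlike_vectors_def)
    have "fp ?x \<in> sp ?x" "fm ?x \<in> sm ?x"
      using lifts that span_base[of "fp ?x" "{fp ?x}"] span_base[of "fm ?x" "{fm ?x}"]
      by (auto simp: lifts_def)
    moreover have "sp ?x \<subseteq> L ?x" "sm ?x \<subseteq> L ?x" "\<forall>a\<in>L ?x. \<forall>b\<in>L ?x. a \<bullet>\<^sub>L b = 0"
      using omega that by (simp_all add: omega_surface_def envelopes_def legendre_immersion_def)
    ultimately show "fp ?x \<bullet>\<^sub>L fm ?x = 0" by blast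
  qed

  \<comment> \<open>Coordinates of \<open>fp\<close> and of its partial derivatives\<close>
  have fp: "fp (\<theta>, t) = - \<epsilon> *\<^sub>R pp + \<kappa>p *\<^sub>R pm + (d t + r t * ((\<psi> t)\<^sup>2 + \<theta>\<^sup>2) / 2) *\<^sub>R v
      + (r t * \<theta>) *\<^sub>R e1 + (r t * \<psi> t) *\<^sub>R e2 + r t *\<^sub>R ov" if "\<theta> \<in> I" "t \<in> J" for \<theta> t
  proof -
    \<comment> \<open>Of the basis vectors with nonzero coefficient only \<open>ov\<close> is moved.
      As \<open>\<rho>1\<close> fixes \<open>e2\<close>, the contributions of the two rotations to
      the coefficient of \<open>v\<close> simply add up.\<close>
    have l: "linear (\<rho>1 \<theta>)" "linear (\<rho>2 (\<psi> t))"
      using \<rho>1 \<rho>2 by (simp_all add: parabolic_rotation_def)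
    note lin = linear_add[OF l(1)] linear_add[OF l(2)] linear_scale[OF l(1)] linear_scale[OF l(2)]
    show ?thesis
      unfolding polar[OF that] from_coords_def
      using \<rho>1 \<rho>2
      by (simp add: parabolic_rotation_def lin linear_0[OF l(1)] linear_0[OF l(2)] linear_diff[OF l(1)] linear_diff[OF l(2)]
          linear_neg[OF l(1)] linear_neg[OF l(2)] algebra_simps add_divide_distrib)
  qed
  have du_fp: "du fp (\<theta>, t) = r t *\<^sub>R (e1 + \<theta> *\<^sub>R v)" if "\<theta> \<in> I" "t \<in> J" for \<theta> t
  proof -
    have "((\<lambda>s. - \<epsilon> *\<^sub>R pp + \<kappa>p *\<^sub>R pm + (d t + r t * ((\<psi> t)\<^sup>2 + s\<^sup>2) / 2) *\<^sub>R v
      + (r t * s) *\<^sub>R e1 + (r t * \<psi> t) *\<^sub>R e2 + r t *\<^sub>R ov) has_vector_derivative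
        r t *\<^sub>R (e1 + \<theta> *\<^sub>R v)) (at \<theta>)"
      by (auto intro!: derivative_eq_intros simp: algebra_simps)
    then have "((\<lambda>s. fp (s, t)) has_vector_derivative r t *\<^sub>R (e1 + \<theta> *\<^sub>R v)) (at \<theta>)"
      by (rule has_vector_derivative_transform_within_open[OF _ I(1) that(1)]) (simp add: fp that)
    then show ?thesis
      using has_vector_derivative_du[OF diff(1)[OF that]] vector_derivative_unique_at by blast
  qed
  have norm_du: "du fp (\<theta>, t) \<bullet>\<^sub>L du fp (\<theta>, t) = (r t)\<^sup>2" if "\<theta> \<in> I" "t \<in> J" for \<theta> t
    by (simp add: du_fp[OF that] bilin b b' power2_eq_square)
  obtain \<theta> where \<theta>: "\<theta> \<in> I" using I(3) by blast
  \<comment> \<open>The duality requires the norm \<open>r\<^sup>2\<close> of \<open>du fp\<close>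
    to be nonzero.\<close>
  have r0: "r t \<noteq> 0" if "t \<in> J" for t
    using chr[OF \<theta> that] norm_du[OF \<theta> that] by auto
  \<comment> \<open>The formula for \<open>d\<close> is exactly the condition that \<open>fp\<close>
    be lightlike.\<close>
  have d: "d t = \<kappa>p * \<Delta> / (2 * r t)" if "t \<in> J" for t
  proof -
    have "\<kappa>p * \<Delta> - 2 * d t * r t = fp (\<theta>, t) \<bullet>\<^sub>L fp (\<theta>, t)"
      by (simp add: fp[OF \<theta> that] bilin b b' gram \<Delta>(1) field_simps power2_eq_square)
    also have "\<dots> = 0" by (rule null(1)[OF \<theta> that])
    finally show ?thesis using r0[OF that] by (simp add: field_simps)
  qed
  have Ck: "Ck_on n J r" "Ck_on n J \<psi>" for n
    using smooth by (simp_all add: smooth_on_def)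
  have r': "(r has_real_derivative deriv r t) (at t)" and \<psi>': "(\<psi> has_real_derivative deriv \<psi> t) (at t)"
    if "t \<in> J" for t
    using Ck_on_real_SucD(1)[OF J(1) Ck(1) that] Ck_on_real_SucD(1)[OF J(1) Ck(2) that] by blast+
  have dv_fp: "dv fp (\<theta>, t) = (- \<kappa>p * \<Delta> * deriv r t / (2 * (r t)\<^sup>2) + deriv r t * ((\<psi> t)\<^sup>2 + \<theta>\<^sup>2) / 2
        + r t * \<psi> t * deriv \<psi> t) *\<^sub>R v + (deriv r t * \<theta>) *\<^sub>R e1
      + (deriv r t * \<psi> t + r t * deriv \<psi> t) *\<^sub>R e2 + deriv r t *\<^sub>R ov" (is "_ = ?D")
    if "t \<in> J" for t
  proof -
    have "((\<lambda>s. \<kappa>p * \<Delta> / (2 * r s) + r s * ((\<psi> s)\<^sup>2 + \<theta>\<^sup>2) / 2) has_real_derivative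
      - \<kappa>p * \<Delta> * deriv r t / (2 * (r t)\<^sup>2) + deriv r t * ((\<psi> t)\<^sup>2 + \<theta>\<^sup>2) / 2 + r t * \<psi> t * deriv \<psi> t) (at t)"
      using r0[OF that]
      by (auto intro!: derivative_eq_intros r'[OF that] \<psi>'[OF that] simp: field_simps power2_eq_square)
    moreover have "((\<lambda>s. r s * \<theta>) has_real_derivative deriv r t * \<theta>) (at t)"
      "((\<lambda>s. r s * \<psi> s) has_real_derivative deriv r t * \<psi> t + r t * deriv \<psi> t) (at t)"
      by (auto intro!: derivative_eq_intros r'[OF that] \<psi>'[OF that])
    \<comment> \<open>The derivative is stated in the shape that the product rule produces; the zero
      summands stem from the constant basis vectors and are removed afterwards.\<close>
    ultimately have "((\<lambda>s. - \<epsilon> *\<^sub>R pp + \<kappa>p *\<^sub>R pm + (\<kappa>p * \<Delta> / (2 * r s) + r s * ((\<psi> s)\<^sup>2 + \<theta>\<^sup>2) / 2) *\<^sub>R v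
      + (r s * \<theta>) *\<^sub>R e1 + (r s * \<psi> s) *\<^sub>R e2 + r s *\<^sub>R ov) has_vector_derivative
        0 + 0 + ((\<kappa>p * \<Delta> / (2 * r t) + r t * ((\<psi> t)\<^sup>2 + \<theta>\<^sup>2) / 2) *\<^sub>R 0 +
          (- \<kappa>p * \<Delta> * deriv r t / (2 * (r t)\<^sup>2) + deriv r t * ((\<psi> t)\<^sup>2 + \<theta>\<^sup>2) / 2 + r t * \<psi> t * deriv \<psi> t) *\<^sub>R v)
        + ((r t * \<theta>) *\<^sub>R 0 + (deriv r t * \<theta>) *\<^sub>R e1)
        + ((r t * \<psi> t) *\<^sub>R 0 + (deriv r t * \<psi> t + r t * deriv \<psi> t) *\<^sub>R e2)
        + (r t *\<^sub>R 0 + deriv r t *\<^sub>R ov)) (at t)"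
      by (intro has_vector_derivative_add has_vector_derivative_scaleR has_vector_derivative_const r'[OF that])
    then have "((\<lambda>s. fp (\<theta>, s)) has_vector_derivative ?D) (at t)"
      unfolding scaleR_zero_right add_0_left
      by (rule has_vector_derivative_transform_within_open[OF _ J(1) that]) (simp add: fp \<theta> d)
    then show ?thesis
      using has_vector_derivative_dv[OF diff(1)[OF \<theta> that]] vector_derivative_unique_at by blast
  qed

  \<comment> \<open>Components of \<open>fm\<close> determined by isotropy and duality\<close>
  have fm_rot: "fm (s, t) \<bullet>\<^sub>L (e1 + s *\<^sub>R v) = 0" if "s \<in> I" "t \<in> J" for s t
  proof -
    note h = has_vector_derivative_du[OF diff(1)[OF that]] has_vector_derivative_du[OF diff(2)[OF that]]
    have 1: "fp (s, t) \<bullet>\<^sub>L du fp (s, t) + du fp (s, t) \<bullet>\<^sub>L fp (s, t) = 0"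
      by (rule lie_inner_zero_derivative[OF I(1) that(1) h(1) h(1)]) (use null that in auto)
    have "fp (s, t) \<bullet>\<^sub>L du fm (s, t) + du fp (s, t) \<bullet>\<^sub>L fm (s, t) = 0"
      by (rule lie_inner_zero_derivative[OF I(1) that(1) h]) (use iso that in auto)
    \<comment> \<open>\<open>du fm\<close> is a multiple of \<open>du fp\<close>, which is
      perpendicular to the lightlike \<open>fp\<close>.\<close>
    moreover have "fp (s, t) \<bullet>\<^sub>L du fm (s, t) = 0"
      using 1 chr[OF that] lie_inner_commute[of "du fp (s, t)" "fp (s, t)"] by (simp add: lie.scaleR_right)
    ultimately have "fm (s, t) \<bullet>\<^sub>L du fp (s, t) = 0"
      using lie_inner_commute[of "fm (s, t)" "du fp (s, t)"] by simp
    then show ?thesis using r0[OF that(2)] by (simp add: du_fp[OF that] lie.scaleR_right)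
  qed
  \<comment> \<open>The relation \<open>fm_rot\<close> holds for every angle and is differentiated
    once more: \<open>e1 + s v\<close> has derivative \<open>v\<close>, and the duality makes the
    pairing of \<open>du fm\<close> with \<open>e1 + \<theta> v\<close> equal to
    \<open>C / r\<close>.\<close>
  have fm_v: "fm (\<theta>, t) \<bullet>\<^sub>L v = - (C / r t)" and fm_e1: "fm (\<theta>, t) \<bullet>\<^sub>L e1 = \<theta> * (C / r t)"
    if "t \<in> J" for t
  proof -
    have "((\<lambda>s. e1 + s *\<^sub>R v) has_vector_derivative v) (at \<theta>)"
      by (auto intro!: derivative_eq_intros)
    from lie_inner_zero_derivative[OF I(1) \<theta> has_vector_derivative_du[OF diff(2)[OF \<theta> that]] this fm_rot]
    have "fm (\<theta>, t) \<bullet>\<^sub>L v + du fm (\<theta>, t) \<bullet>\<^sub>L (e1 + \<theta> *\<^sub>R v) = 0" using that by simp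
    moreover have "du fm (\<theta>, t) = (C / (r t)\<^sup>2) *\<^sub>R (r t *\<^sub>R (e1 + \<theta> *\<^sub>R v))"
      using chr[OF \<theta> that] unfolding norm_du[OF \<theta> that] unfolding du_fp[OF \<theta> that] by blast
    moreover have "C / (r t)\<^sup>2 * r t = C / r t" using r0[OF that] by (simp add: power2_eq_square)
    ultimately show *: "fm (\<theta>, t) \<bullet>\<^sub>L v = - (C / r t)" by (simp add: bilin b b')
    then show "fm (\<theta>, t) \<bullet>\<^sub>L e1 = \<theta> * (C / r t)" using fm_rot[OF \<theta> that] by (simp add: bilin)
  qed
  have fm_dv: "fm (\<theta>, t) \<bullet>\<^sub>L dv fp (\<theta>, t) = 0" if "t \<in> J" for t
  proof -
    note h = has_vector_derivative_dv[OF diff(1)[OF \<theta> that]] has_vector_derivative_dv[OF diff(2)[OF \<theta> that]]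
    have 1: "fp (\<theta>, t) \<bullet>\<^sub>L dv fp (\<theta>, t) + dv fp (\<theta>, t) \<bullet>\<^sub>L fp (\<theta>, t) = 0"
      by (rule lie_inner_zero_derivative[OF J(1) that h(1) h(1)]) (use null \<theta> in auto)
    have "fp (\<theta>, t) \<bullet>\<^sub>L dv fm (\<theta>, t) + dv fp (\<theta>, t) \<bullet>\<^sub>L fm (\<theta>, t) = 0"
      by (rule lie_inner_zero_derivative[OF J(1) that h]) (use iso \<theta> in auto)
    moreover have "fp (\<theta>, t) \<bullet>\<^sub>L dv fm (\<theta>, t) = 0"
      using 1 chr[OF \<theta> that] lie_inner_commute[of "dv fp (\<theta>, t)" "fp (\<theta>, t)"]
      by (simp add: lie.scaleR_right lie.minus_right)
    ultimately show ?thesis using lie_inner_commute[of "fm (\<theta>, t)" "dv fp (\<theta>, t)"] by simp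
  qed

  \<comment> \<open>Equations of the profile curve\<close>
  define \<eta> where "\<eta> t = fm (\<theta>, t) \<bullet>\<^sub>L e2 + \<psi> t * (fm (\<theta>, t) \<bullet>\<^sub>L v)" for t
  have \<eta>: "(\<eta> t)\<^sup>2 * r t ^ 4 = - \<Delta> * (\<kappa>m * r t ^ 4 + 2 * C * \<epsilon> * (r t)\<^sup>2 + \<kappa>p * C\<^sup>2)"
    "r t ^ 4 * deriv \<psi> t * \<eta> t = - \<Delta> * deriv r t * (\<epsilon> * (r t)\<^sup>2 + \<kappa>p * C)" if "t \<in> J" for t
  proof -
    let ?x = "fm (\<theta>, t)"
    have n: "?x \<bullet>\<^sub>L pp = \<Delta>" "?x \<bullet>\<^sub>L pm = 0" using normalized(2) \<theta> that by simp_all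
    note x = n fm_v[OF that] fm_e1[OF that]
    \<comment> \<open>As \<open>fm\<close> pairs to \<open>\<Delta>\<close> with \<open>pp\<close>
      and to 0 with \<open>pm\<close>, the plane of the sphere complexes contributes just
      \<open>\<kappa>m \<Delta>\<close> to the norm.\<close>
    have eq1: "\<kappa>m * \<Delta> + 2 * (C / r t) * (?x \<bullet>\<^sub>L ov) + (\<theta> * (C / r t))\<^sup>2 + (?x \<bullet>\<^sub>L e2)\<^sup>2 = 0"
      using lie_inner_adapted_basis[OF basis \<Delta>[unfolded \<kappa>p \<kappa>m \<epsilon>], of ?x] null(2)[OF \<theta> that] \<Delta>neg
      by (simp add: x gram power2_eq_square)
    have "?x \<bullet>\<^sub>L fp (\<theta>, t) = 0" using iso[OF \<theta> that] lie_inner_commute[of "fm (\<theta>, t)" "fp (\<theta>, t)"] by simp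
    then have eq2: "- \<epsilon> * \<Delta> - (\<kappa>p * \<Delta> / (2 * r t) + r t * ((\<psi> t)\<^sup>2 + \<theta>\<^sup>2) / 2) * (C / r t)
        + r t * \<theta> * (\<theta> * (C / r t)) + r t * \<psi> t * (?x \<bullet>\<^sub>L e2) + r t * (?x \<bullet>\<^sub>L ov) = 0"
      unfolding fp[OF \<theta> that] d[OF that] bilin x by simp
    have eq3: "- (- \<kappa>p * \<Delta> * deriv r t / (2 * (r t)\<^sup>2) + deriv r t * ((\<psi> t)\<^sup>2 + \<theta>\<^sup>2) / 2
          + r t * \<psi> t * deriv \<psi> t) * (C / r t) + deriv r t * \<theta> * (\<theta> * (C / r t))
        + (deriv r t * \<psi> t + r t * deriv \<psi> t) * (?x \<bullet>\<^sub>L e2) + deriv r t * (?x \<bullet>\<^sub>L ov) = 0"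
      using fm_dv[OF that] unfolding dv_fp[OF that] bilin x by (simp only: real_scaleR_def mult_minus_left mult_minus_right)
    \<comment> \<open>Since \<open>\<rho>2 \<psi> e2 = e2 + \<psi> v\<close>, \<open>\<eta>\<close>
      pairs \<open>fm\<close> with the rotated \<open>e2\<close>; the component along
      \<open>v\<close> is already known.\<close>
    have "\<eta> t = ?x \<bullet>\<^sub>L e2 - \<psi> t * (C / r t)" by (simp add: \<eta>_def x)
    from dual_lift_equations[OF r0[OF that] eq1 eq2 eq3 this]
    show "(\<eta> t)\<^sup>2 * r t ^ 4 = - \<Delta> * (\<kappa>m * r t ^ 4 + 2 * C * \<epsilon> * (r t)\<^sup>2 + \<kappa>p * C\<^sup>2)"
      "r t ^ 4 * deriv \<psi> t * \<eta> t = - \<Delta> * deriv r t * (\<epsilon> * (r t)\<^sup>2 + \<kappa>p * C)" .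
  qed

  \<comment> \<open>Comparison with the claimed velocity\<close>
  define k where "k = sqrt (- 1 / \<Delta>)"
  \<comment> \<open>The factor \<open>k^3\<close> turns
    \<open>\<eta>\<^sup>2 r^4 = - \<Delta> p\<^sub>C(r\<^sup>2)\<close> into the required value of
    \<open>A\<^sup>2\<close>. The claim prescribes only the square of \<open>r'\<close>; taking its
    sign from \<open>\<eta>\<close> lets \<open>B\<close> be the claimed \<open>\<psi>'\<close> with
    the positive root.\<close>
  define A where "A t = k ^ 3 * (\<eta> t * (r t)\<^sup>2)" for t
  define B where "B t = k * ((\<epsilon> * (r t)\<^sup>2 + \<kappa>p * C) * (inverse (r t))\<^sup>2)" for t
  define \<mu> where "\<mu> t = (\<kappa>p * \<Delta> * (A t * deriv r t * (inverse (r t))\<^sup>2) + (r t)\<^sup>2 * (B t * deriv \<psi> t))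
    * (inverse (r t))\<^sup>2" for t
  have vel: "(A t)\<^sup>2 = (\<kappa>m * r t ^ 4 + 2 * C * \<epsilon> * (r t)\<^sup>2 + \<kappa>p * C\<^sup>2) / \<Delta>\<^sup>2"
    "deriv r t = \<mu> t * A t" "deriv \<psi> t = \<mu> t * B t" if "t \<in> J" for t
    using proportional_velocity[OF r0[OF that] \<Delta> \<Delta>neg \<eta>[OF that] k_def A_def B_def \<mu>_def] by blast+
  \<comment> \<open>At a zero of \<open>\<mu>\<close> both \<open>r'\<close> and
    \<open>\<psi>'\<close> vanish, hence so does \<open>dv fp\<close>, contrary to its nonzero
    norm.\<close>
  have \<mu>0: "\<mu> t \<noteq> 0" if "t \<in> J" for t
  proof
    assume "\<mu> t = 0"
    then have "dv fp (\<theta>, t) = 0" using vel[OF that] dv_fp[OF that] by simp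
    then show False using chr[OF \<theta> that] by (simp add: bilin)
  qed
  \<comment> \<open>\<open>\<mu>\<close> is a polynomial expression in \<open>\<eta>\<close>,
    \<open>r\<close>, \<open>1 / r\<close> and the derivatives of \<open>r\<close> and
    \<open>\<psi>\<close>; the smoothness of \<open>\<eta>\<close> is inherited from the lift
    \<open>fm\<close>.\<close>
  have "Ck_on n J \<mu>" for n
  proof -
    note mult = Ck_on_mult[OF J(1)] and add = Ck_on_add[OF J(1)] and power = Ck_on_power[OF J(1)]
    have inv: "Ck_on n J (\<lambda>t. (inverse (r t))\<^sup>2)"
      by (rule power[OF Ck_on_inverse[OF J(1) r0 Ck(1)]])
    have der: "Ck_on n J (deriv r)" "Ck_on n J (deriv \<psi>)"
      using Ck_on_real_SucD(2)[OF J(1) Ck(1)] Ck_on_real_SucD(2)[OF J(1) Ck(2)] by blast+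
    have r2: "Ck_on n J (\<lambda>t. (r t)\<^sup>2)" by (rule power[OF Ck(1)])
    note slice = Ck_on_slice_lie_inner[OF I(1) J(1) \<theta> Ck_fm]
    have "Ck_on n J \<eta>" unfolding \<eta>_def[abs_def] by (rule add[OF slice mult[OF Ck(2) slice]])
    then have A: "Ck_on n J A"
      unfolding A_def[abs_def] by (rule mult[OF Ck_on_const mult[OF _ r2]])
    have B: "Ck_on n J B"
      unfolding B_def[abs_def]
      by (rule mult[OF Ck_on_const mult[OF add[OF mult[OF Ck_on_const r2] Ck_on_const] inv]])
    show ?thesis
      unfolding \<mu>_def[abs_def]
      by (rule mult[OF add[OF mult[OF Ck_on_const mult[OF mult[OF A der(1)] inv]]
            mult[OF r2 mult[OF B der(2)]]] inv])
  qed
  then have "smooth_on J \<mu>" by (simp add: smooth_on_def)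

  \<comment> \<open>Change of parameter and roots of the polynomial\<close>
  from smooth_reparametrization[OF J(1,2) this \<mu>0] obtain J' \<phi> where
    \<phi>: "open J'" "is_interval J'" "smooth_on J' \<phi>" "bij_betw \<phi> J' J"
    and \<phi>': "\<And>t. t \<in> J' \<Longrightarrow> (\<phi> has_real_derivative inverse (\<mu> (\<phi> t))) (at t)"
    by blast
  have \<phi>J: "\<phi> t \<in> J" if "t \<in> J'" for t using \<phi>(4) that bij_betwE by blast
  obtain C1 C2 where roots:
    "\<And>x. \<kappa>m * x\<^sup>2 + 2 * C * \<epsilon> * x + \<kappa>p * C\<^sup>2 = \<kappa>m * (x - C1) * (x - C2)"
    using quadratic_roots[OF \<Delta> \<Delta>neg \<kappa>m_nonzero] by blast
  have "poly [:\<kappa>p * C\<^sup>2, 2 * C * \<epsilon>, \<kappa>m:] x = \<kappa>m * (x - C1) * (x - C2)" for x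
    using roots[of x] by (simp add: algebra_simps power2_eq_square)
  then have set: "{x. poly [:\<kappa>p * C\<^sup>2, 2 * C * \<epsilon>, \<kappa>m:] x = 0} = {C1, C2}"
    using \<kappa>m_nonzero by (auto simp del: poly_pCons)
  \<comment> \<open>By the chain rule the factor \<open>1 / \<mu>\<close> from
    \<open>\<phi>'\<close> cancels the factor \<open>\<mu>\<close> in \<open>r'\<close> and
    \<open>\<psi>'\<close>.\<close>
  have rr: "(r \<circ> \<phi> has_real_derivative A (\<phi> t)) (at t)"
    and pp: "(\<psi> \<circ> \<phi> has_real_derivative B (\<phi> t)) (at t)" if "t \<in> J'" for t
    using DERIV_chain[OF r'[OF \<phi>J[OF that]] \<phi>'[OF that]] DERIV_chain[OF \<psi>'[OF \<phi>J[OF that]] \<phi>'[OF that]]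
      vel(2,3)[OF \<phi>J[OF that]] \<mu>0[OF \<phi>J[OF that]] by (simp_all add: field_simps)
  show ?thesis
  proof (intro exI conjI ballI)
    show "{x. poly [:\<kappa>p * C\<^sup>2, 2 * C * \<epsilon>, \<kappa>m:] x = 0} = {C1, C2}" by (rule set)
    show "open J'" "is_interval J'" "smooth_on J' \<phi>" "bij_betw \<phi> J' J" by (rule \<phi>)+
    fix t assume t: "t \<in> J'"
    show "deriv \<phi> t \<noteq> 0" using DERIV_imp_deriv[OF \<phi>'[OF t]] \<mu>0[OF \<phi>J[OF t]] by simp
    show "(r \<circ> \<phi> has_real_derivative A (\<phi> t)) (at t)" by (rule rr[OF t])
    have "r (\<phi> t) ^ 4 = ((r (\<phi> t))\<^sup>2)\<^sup>2" by (simp add: power_mult[symmetric])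
    then show "(A (\<phi> t))\<^sup>2 = \<kappa>m / \<Delta>\<^sup>2 * ((r (\<phi> t))\<^sup>2 - C1) * ((r (\<phi> t))\<^sup>2 - C2)"
      using vel(1)[OF \<phi>J[OF t]] roots[of "(r (\<phi> t))\<^sup>2"] by simp
    show "(\<psi> \<circ> \<phi> has_real_derivative
        sqrt (- 1 / \<Delta>) * ((\<epsilon> * (r (\<phi> t))\<^sup>2 + \<kappa>p * C) / (r (\<phi> t))\<^sup>2)) (at t)"
      using pp[OF t] by (simp add: B_def k_def field_simps)
    show "d (\<phi> t) = \<kappa>p * \<Delta> / (2 * r (\<phi> t))" by (rule d[OF \<phi>J[OF t]])
  qed
qed

end
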